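(* The Poisson bi-vector field for the relative $\mathrm{SL}(3,\mathbb{C})$-character variety of the one-holed torus is \begin{align*} &\Sigma_1\Big(\mathfrak{a}_{1,2}\frac{\partial}{\partial t_{(1)}}\wedge\frac{\partial}{\partial t_{(2)}}\Big)+\Sigma_2\Big(\mathfrak{a}_{3,4}\frac{\partial}{\partial t_{(3)}}\wedge\frac{\partial}{\partial t_{(4)}}\Big)\\ &+\frac12\Sigma_1\Sigma_2\Big(\mathfrak{a}_{1,3}\frac{\partial}{\partial t_{(1)}}\wedge\frac{\partial}{\partial t_{(3)}}+\mathfrak{a}_{1,-3}\frac{\partial}{\partial t_{(1)}}\wedge\frac{\partial}{\partial t_{(-3)}}\Big), \end{align*} where - $\mathfrak{a}_{1,2}=t_{(3)}-\frac13t_{(1)}t_{(2)}$, - $\mathfrak{a}_{1,3}=\frac23t_{(1)}t_{(3)}-t_{(-1)}t_{(2)}+t_{(-4)}$, - $\mathfrak{a}_{1,-3}=-t_{(-2)}+\frac13t_{(1)}t_{(-3)}$, - $\mathfrak{a}_{3,4}=-t_{(1)}^2+t_{(-1)}-t_{(-4)}t_{(-2)}-t_{(2)}t_{(-3)}+t_{(-1)}t_{(2)}t_{(-2)}-\frac13t_{(3)}t_{(4)}$.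
   Context: Let $T$ be the one-holed torus (a torus with an open disk removed), with $\pi_1(T)=\langle x_1,x_2,x_3\mid x_1x_2x_1^{-1}x_2^{-1}x_3=1\rangle$, where $x_3$ is the boundary curve; $\pi_1(T)$ is free on $x_1,x_2$. Let $\mathfrak{G}=\mathrm{SL}(3,\mathbb{C})$ and $\mathfrak{X}=\mathrm{Hom}(\pi_1(T),\mathfrak{G})/\!\!/\mathfrak{G}=\mathfrak{G}^{\times2}/\!\!/\mathfrak{G}$ (quotient by simultaneous conjugation), together with its boundary map. With generic matrices $X_1,X_2\in\mathfrak{G}$ (images of $x_1,x_2$), put $t_{(1)}=\mathrm{tr}(X_1)$, $t_{(-1)}=\mathrm{tr}(X_1^{-1})$, $t_{(2)}=\mathrm{tr}(X_2)$, $t_{(-2)}=\mathrm{tr}(X_2^{-1})$, $t_{(3)}=\mathrm{tr}(X_1X_2)$, $t_{(-3)}=\mathrm{tr}(X_1^{-1}X_2^{-1})$, $t_{(4)}=\mathrm{tr}(X_1X_2^{-1})$, $t_{(-4)}=\mathrm{tr}(X_1^{-1}X_2)$, $t_{(5)}=\mathrm{tr}(X_1X_2X_1^{-1}X_2^{-1})$. It is known that these nine elements generate $\mathbb{C}[\mathfrak{X}]$. The Poisson bracket is the bilinear, anti-commutative derivation on $\mathbb{C}[\mathfrak X]$ given on trace functions by $\{\mathrm{tr}(\rho(\alpha)),\mathrm{tr}(\rho(\beta))\}=\sum_{p\in\alpha\cap\beta}\epsilon(p,\alpha,\beta)\big(\mathrm{tr}(\rho(\alpha_p\beta_p))-\tfrac13\mathrm{tr}(\rho(\alpha))\mathrm{tr}(\rho(\beta))\big)$,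 where $\alpha,\beta$ are represented by immersed closed curves in generic position in $T$, $\alpha\cap\beta$ is the set of transverse double point intersections, $\epsilon(p,\alpha,\beta)=\pm1$ is the oriented intersection number at $p$, and $\alpha_p,\beta_p\in\pi_1(T,p)$ are the curves based at $p$. The orientation of $T$ (reversing it multiplies the bracket by $-1$) is the one for which $x_1$ and $x_2$, meeting once at $p$, have $\epsilon(p,x_1,x_2)=+1$. Bi-vector convention: a bi-vector field $\sum\mathfrak{a}_{i,j}\frac{\partial}{\partial z_i}\wedge\frac{\partial}{\partial z_j}$ corresponds to $\{f,g\}=\sum\mathfrak{a}_{i,j}\big(\frac{\partial f}{\partial z_i}\frac{\partial g}{\partial z_j}-\frac{\partial f}{\partial z_j}\frac{\partial g}{\partial z_i}\big)$, with each pair appearing in the sum counted once; here the $z_i$ are the generators above, and $\mathfrak{a}_{i,j}=\{t_{(i)},t_{(j)}\}$. An outer automorphism $\sigma$ of the free group on $x_1,x_2$ acts on $\mathbb{C}[\mathfrak{X}]$ by $\mathrm{tr}(W)\mapsto\mathrm{tr}(\sigma(W))$. Let $\mathfrak{t}$ exchange $x_1,x_2$; let $\mathfrak{i}_1$ send $x_1\mapsto x_1^{-1}$, $x_2\mapsto x_2$; let $\mathfrak{i}_2=\mathfrak{t}\mathfrak{i}_1\mathfrak{t}$ (so $x_1\mapsto x_1$, $x_2\mapsto x_2^{-1}$); and let $\mathfrak{i}=\mathfrak{i}_1\mathfrak{i}_2$ (so $x_i\mapsto x_i^{-1}$). Let $\mathfrak{D}$ be the group generated by $\mathfrak{t},\mathfrak{i}_1$,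 which is isomorphic to the dihedral group $D_4$ of order 8. In the group ring of $\mathfrak{D}$ set $$\Sigma_1=1+\mathfrak{i}-\mathfrak{i}_1-\mathfrak{i}_2,\qquad\Sigma_2=1+\mathfrak{i}-\mathfrak{t}-\mathfrak{i}\mathfrak{t},$$ so that $\frac12\Sigma_1\Sigma_2=1+\mathfrak{i}-\mathfrak{i}_1-\mathfrak{i}_2-\mathfrak{t}-\mathfrak{i}\mathfrak{t}+\mathfrak{i}_1\mathfrak{t}+\mathfrak{i}_2\mathfrak{t}$. Each $\sigma\in\mathfrak{D}$ permutes $\{t_{(\pm i)}:1\le i\le4\}$ and acts on bi-vector terms by $\sigma\big(a\frac{\partial}{\partial u}\wedge\frac{\partial}{\partial v}\big)=\sigma(a)\frac{\partial}{\partial\sigma(u)}\wedge\frac{\partial}{\partial\sigma(v)}$; products act by composition with the right factor applied first (e.g. $\mathfrak{i}_1\mathfrak{t}$ sends $t_{(1)}\mapsto t_{(2)}$, $t_{(3)}\mapsto t_{(-4)}$). *)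

theory Defs
  imports "HOL-Analysis.Analysis" "HOL-Library.Function_Algebras"
begin

section \<open>The character variety of the free group of rank two\<close>

typedef sl3 = "{A :: complex^3^3. det A = 1}"
  by (rule exI[of _ "mat 1"]) simp

definition sl3_times :: "sl3 \<Rightarrow> sl3 \<Rightarrow> sl3" where
  "sl3_times A B = Abs_sl3 (Rep_sl3 A ** Rep_sl3 B)"

definition sl3_inv :: "sl3 \<Rightarrow> sl3" where
  "sl3_inv A = Abs_sl3 (matrix_inv (Rep_sl3 A))"

lemma det_Rep_sl3: "det (Rep_sl3 A) = 1"
  using Rep_sl3[of A] by simp

lemma matrix_inv_Rep_sl3:
  "Rep_sl3 A ** matrix_inv (Rep_sl3 A) = mat 1" "matrix_inv (Rep_sl3 A) ** Rep_sl3 A = mat 1"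
proof -
  have "invertible (Rep_sl3 A)"
    by (simp add: invertible_det_nz det_Rep_sl3)
  then show "Rep_sl3 A ** matrix_inv (Rep_sl3 A) = mat 1" "matrix_inv (Rep_sl3 A) ** Rep_sl3 A = mat 1"
    unfolding invertible_def matrix_inv_def by (metis (mono_tags, lifting) someI_ex)+
qed

lemma Rep_sl3_times: "Rep_sl3 (sl3_times A B) = Rep_sl3 A ** Rep_sl3 B"
  by (simp add: sl3_times_def Abs_sl3_inverse det_mul det_Rep_sl3)

lemma Rep_sl3_inv: "Rep_sl3 (sl3_inv A) = matrix_inv (Rep_sl3 A)"
proof -
  have "det (Rep_sl3 A) * det (matrix_inv (Rep_sl3 A)) = 1"
    by (metis det_mul matrix_inv_Rep_sl3(1) det_I)
  then have "det (matrix_inv (Rep_sl3 A)) = 1"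
    by (simp add: det_Rep_sl3)
  then show ?thesis
    by (simp add: sl3_inv_def Abs_sl3_inverse)
qed

lemma sl3_inv_inv: "sl3_inv (sl3_inv A) = A"
proof -
  have "matrix_inv (matrix_inv (Rep_sl3 A)) = Rep_sl3 A"
    by (metis Rep_sl3_inv matrix_inv_Rep_sl3 matrix_mul_assoc matrix_mul_lid matrix_mul_rid)
  then show ?thesis
    by (metis Rep_sl3_inject Rep_sl3_inv)
qed

text \<open>A representation of the free group on \<open>x\<^sub>1, x\<^sub>2\<close> is the pair of images of the generators.\<close>

type_synonym rep = "sl3 \<times> sl3"

inductive_set regular :: "(rep \<Rightarrow> complex) set" where
  const: "(\<lambda>\<rho>. c) \<in> regular"
| entry1: "(\<lambda>\<rho>. Rep_sl3 (fst \<rho>) $ i $ j) \<in> regular"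
| entry2: "(\<lambda>\<rho>. Rep_sl3 (snd \<rho>) $ i $ j) \<in> regular"
| add: "f \<in> regular \<Longrightarrow> g \<in> regular \<Longrightarrow> f + g \<in> regular"
| mult: "f \<in> regular \<Longrightarrow> g \<in> regular \<Longrightarrow> f * g \<in> regular"

definition conjugate :: "sl3 \<Rightarrow> rep \<Rightarrow> rep" where
  "conjugate g \<rho> = (sl3_times g (sl3_times (fst \<rho>) (sl3_inv g)),
                     sl3_times g (sl3_times (snd \<rho>) (sl3_inv g)))"

text \<open>The coordinate ring of the quotient by simultaneous conjugation.\<close>

definition char_ring :: "(rep \<Rightarrow> complex) set" where
  "char_ring = {f \<in> regular. \<forall>g \<rho>. f (conjugate g \<rho>) = f \<rho>}"

definition scal :: "complex \<Rightarrow> (rep \<Rightarrow> complex) \<Rightarrow> rep \<Rightarrow> complex" where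
  "scal c f = (\<lambda>\<rho>. c * f \<rho>)"

datatype letter = X1 | X1inv | X2 | X2inv

type_synonym word = "letter list"

fun letter_val :: "rep \<Rightarrow> letter \<Rightarrow> sl3" where
  "letter_val \<rho> X1 = fst \<rho>"
| "letter_val \<rho> X1inv = sl3_inv (fst \<rho>)"
| "letter_val \<rho> X2 = snd \<rho>"
| "letter_val \<rho> X2inv = sl3_inv (snd \<rho>)"

fun word_mat :: "rep \<Rightarrow> word \<Rightarrow> complex^3^3" where
  "word_mat \<rho> [] = mat 1"
| "word_mat \<rho> (l # w) = Rep_sl3 (letter_val \<rho> l) ** word_mat \<rho> w"

definition tr_word :: "word \<Rightarrow> rep \<Rightarrow> complex" where
  "tr_word w = (\<lambda>\<rho>. trace (word_mat \<rho> w))"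

text \<open>\<open>Zk\<close> and \<open>Zmk\<close> index the generators \<open>t\<^sub>(\<^sub>k\<^sub>)\<close> and \<open>t\<^sub>(\<^sub>-\<^sub>k\<^sub>)\<close>.\<close>

datatype coord = Z1 | Zm1 | Z2 | Zm2 | Z3 | Zm3 | Z4 | Zm4 | Z5

lemma UNIV_coord: "UNIV = {Z1, Zm1, Z2, Zm2, Z3, Zm3, Z4, Zm4, Z5}"
  using coord.exhaust by auto

instance coord :: finite
  by standard (simp add: UNIV_coord)

fun coord_word :: "coord \<Rightarrow> word" where
  "coord_word Z1 = [X1]"
| "coord_word Zm1 = [X1inv]"
| "coord_word Z2 = [X2]"
| "coord_word Zm2 = [X2inv]"
| "coord_word Z3 = [X1, X2]"
| "coord_word Zm3 = [X1inv, X2inv]"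
| "coord_word Z4 = [X1, X2inv]"
| "coord_word Zm4 = [X1inv, X2]"
| "coord_word Z5 = [X1, X2, X1inv, X2inv]"

definition tg :: "coord \<Rightarrow> rep \<Rightarrow> complex" where
  "tg k = tr_word (coord_word k)"


section \<open>Curves on the one-holed torus\<close>

text \<open>
  The torus is the product of two unit circles in \<open>\<complex> \<times> \<complex>\<close>; the removed open disk is the set
  of its points at distance less than \<open>1\<close> from \<open>(-1, -1)\<close>.
\<close>

definition one_holed_torus :: "(complex \<times> complex) set" where
  "one_holed_torus = {p. cmod (fst p) = 1 \<and> cmod (snd p) = 1} - ball (-1, -1) 1"

definition loop1 :: "real \<Rightarrow> complex \<times> complex" where
  "loop1 = (\<lambda>s. (cis (2 * pi * s), 1))"

definition loop2 :: "real \<Rightarrow> complex \<times> complex" where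
  "loop2 = (\<lambda>s. (1, cis (2 * pi * s)))"

fun letter_loop :: "letter \<Rightarrow> real \<Rightarrow> complex \<times> complex" where
  "letter_loop X1 = loop1"
| "letter_loop X1inv = reversepath loop1"
| "letter_loop X2 = loop2"
| "letter_loop X2inv = reversepath loop2"

fun word_loop :: "word \<Rightarrow> real \<Rightarrow> complex \<times> complex" where
  "word_loop [] = linepath (1, 1) (1, 1)"
| "word_loop (l # w) = letter_loop l +++ word_loop w"

text \<open>
  The function \<open>\<rho> \<mapsto> tr (\<rho>(\<gamma>))\<close> of a loop \<open>\<gamma>\<close> depends only on its free homotopy class; it is
  \<open>tr_word w\<close> for any word \<open>w\<close> in the free generators whose loop is freely homotopic to \<open>\<gamma>\<close>.
\<close>

definition represents :: "word \<Rightarrow> (real \<Rightarrow> complex \<times> complex) \<Rightarrow> bool" where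
  "represents w \<gamma> \<longleftrightarrow> homotopic_loops one_holed_torus (word_loop w) \<gamma>"

text \<open>Closed curves are maps on the circle \<open>\<real>/\<int>\<close>, i.e. 1-periodic maps on the line.\<close>

definition immersed_closed_curve :: "(real \<Rightarrow> complex \<times> complex) \<Rightarrow> bool" where
  "immersed_closed_curve \<gamma> \<longleftrightarrow>
     \<gamma> C1_differentiable_on UNIV \<and>
     (\<forall>s. vector_derivative \<gamma> (at s) \<noteq> 0) \<and>
     (\<forall>s. \<gamma> (s + 1) = \<gamma> s) \<and>
     range \<gamma> \<subseteq> one_holed_torus"

text \<open>
  A vector tangent to the torus at \<open>(z, w)\<close> has the form \<open>(\<i> a z, \<i> b w)\<close> with \<open>a, b\<close> real;
  its components \<open>a, b\<close> in the angular coordinates are recovered by \<open>Im (cnj z * _)\<close> and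
  \<open>Im (cnj w * _)\<close>. The angular coordinates are positively oriented, see
  \<open>intersection_sign_loops\<close>.
\<close>

definition angular_velocity1 :: "(real \<Rightarrow> complex \<times> complex) \<Rightarrow> real \<Rightarrow> real" where
  "angular_velocity1 \<gamma> s = Im (cnj (fst (\<gamma> s)) * fst (vector_derivative \<gamma> (at s)))"

definition angular_velocity2 :: "(real \<Rightarrow> complex \<times> complex) \<Rightarrow> real \<Rightarrow> real" where
  "angular_velocity2 \<gamma> s = Im (cnj (snd (\<gamma> s)) * snd (vector_derivative \<gamma> (at s)))"

definition tangent_det ::
  "(real \<Rightarrow> complex \<times> complex) \<Rightarrow> real \<Rightarrow> (real \<Rightarrow> complex \<times> complex) \<Rightarrow> real \<Rightarrow> real" where
  "tangent_det \<alpha> s \<beta> u =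
     angular_velocity1 \<alpha> s * angular_velocity2 \<beta> u - angular_velocity2 \<alpha> s * angular_velocity1 \<beta> u"

definition intersection_sign ::
  "(real \<Rightarrow> complex \<times> complex) \<Rightarrow> real \<Rightarrow> (real \<Rightarrow> complex \<times> complex) \<Rightarrow> real \<Rightarrow> real" where
  "intersection_sign \<alpha> s \<beta> u = sgn (tangent_det \<alpha> s \<beta> u)"

definition crossings ::
  "(real \<Rightarrow> complex \<times> complex) \<Rightarrow> (real \<Rightarrow> complex \<times> complex) \<Rightarrow> (real \<times> real) set" where
  "crossings \<alpha> \<beta> = {(s, u). s \<in> {0..<1} \<and> u \<in> {0..<1} \<and> \<alpha> s = \<beta> u}"

text \<open>
  All multiple points of the union of the two curves are transverse double points. Hence an
  intersection point of \<open>\<alpha>\<close> and \<open>\<beta>\<close> is passed exactly once by each of them, and \<open>crossings \<alpha> \<beta>\<close>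
  is in bijection with the set of intersection points.
\<close>

definition generic_position ::
  "(real \<Rightarrow> complex \<times> complex) \<Rightarrow> (real \<Rightarrow> complex \<times> complex) \<Rightarrow> bool" where
  "generic_position \<alpha> \<beta> \<longleftrightarrow>
     (\<forall>(s, u) \<in> crossings \<alpha> \<beta>. tangent_det \<alpha> s \<beta> u \<noteq> 0) \<and>
     (\<forall>(s, u) \<in> crossings \<alpha> \<alpha>. s \<noteq> u \<longrightarrow> tangent_det \<alpha> s \<alpha> u \<noteq> 0) \<and>
     (\<forall>(s, u) \<in> crossings \<beta> \<beta>. s \<noteq> u \<longrightarrow> tangent_det \<beta> s \<beta> u \<noteq> 0) \<and>
     (\<forall>p. card {s \<in> {0..<1}. \<alpha> s = p} + card {u \<in> {0..<1}. \<beta> u = p} \<le> 2)"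

text \<open>The loop \<open>\<gamma>\<^sub>p\<close> based at the point \<open>p = \<gamma> s\<close>.\<close>

definition based_at :: "(real \<Rightarrow> complex \<times> complex) \<Rightarrow> real \<Rightarrow> real \<Rightarrow> complex \<times> complex" where
  "based_at \<gamma> s = (\<lambda>v. \<gamma> (s + v))"

lemma intersection_sign_loops: "intersection_sign loop1 0 loop2 0 = 1"
proof -
  have c: "((\<lambda>s::real. cis (2 * pi * s)) has_vector_derivative 2 * pi * \<i>) (at 0)"
  proof -
    have "((\<lambda>z::complex. exp (\<i> * (2 * pi * z))) has_field_derivative 2 * pi * \<i>) (at (of_real 0))"
      by (auto intro!: derivative_eq_intros)
    then show ?thesis
      by (drule_tac has_vector_derivative_real_field) (simp add: cis_conv_exp)
  qed
  have "(loop1 has_vector_derivative (2 * pi * \<i>, 0)) (at 0)"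
    unfolding loop1_def by (intro has_vector_derivative_Pair c has_vector_derivative_const)
  moreover have "(loop2 has_vector_derivative (0, 2 * pi * \<i>)) (at 0)"
    unfolding loop2_def by (intro has_vector_derivative_Pair c has_vector_derivative_const)
  ultimately show ?thesis
    by (simp add: intersection_sign_def tangent_det_def angular_velocity1_def angular_velocity2_def
        vector_derivative_at loop1_def loop2_def sgn_if)
qed


section \<open>The Poisson bracket\<close>

locale goldman_bracket =
  fixes br :: "(rep \<Rightarrow> complex) \<Rightarrow> (rep \<Rightarrow> complex) \<Rightarrow> (rep \<Rightarrow> complex)"
  assumes closed: "f \<in> char_ring \<Longrightarrow> g \<in> char_ring \<Longrightarrow> br f g \<in> char_ring"
    and add_left: "f \<in> char_ring \<Longrightarrow> g \<in> char_ring \<Longrightarrow> h \<in> char_ring \<Longrightarrow>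
      br (f + g) h = br f h + br g h"
    and scal_left: "f \<in> char_ring \<Longrightarrow> h \<in> char_ring \<Longrightarrow> br (scal c f) h = scal c (br f h)"
    and anticommute: "f \<in> char_ring \<Longrightarrow> g \<in> char_ring \<Longrightarrow> br g f = - br f g"
    and leibniz: "f \<in> char_ring \<Longrightarrow> g \<in> char_ring \<Longrightarrow> h \<in> char_ring \<Longrightarrow>
      br (f * g) h = f * br g h + g * br f h"
    and goldman: "immersed_closed_curve \<alpha> \<Longrightarrow> immersed_closed_curve \<beta> \<Longrightarrow> generic_position \<alpha> \<beta> \<Longrightarrow>
      represents a \<alpha> \<Longrightarrow> represents b \<beta> \<Longrightarrow>
      (\<And>s u. (s, u) \<in> crossings \<alpha> \<beta> \<Longrightarrow> represents (w s u) (based_at \<alpha> s +++ based_at \<beta> u)) \<Longrightarrow>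
      br (tr_word a) (tr_word b) =
        (\<Sum>(s, u) \<in> crossings \<alpha> \<beta>. scal (of_real (intersection_sign \<alpha> s \<beta> u))
           (tr_word (w s u) - scal (1/3) (tr_word a * tr_word b)))"


section \<open>Bi-vector fields\<close>

text \<open>Polynomials in the nine variables \<open>z\<^sub>i\<close>, as functions on affine space.\<close>

inductive_set poly_fun :: "((coord \<Rightarrow> complex) \<Rightarrow> complex) set" where
  const: "(\<lambda>z. c) \<in> poly_fun"
| var: "(\<lambda>z. z k) \<in> poly_fun"
| add: "F \<in> poly_fun \<Longrightarrow> G \<in> poly_fun \<Longrightarrow> F + G \<in> poly_fun"
| mult: "F \<in> poly_fun \<Longrightarrow> G \<in> poly_fun \<Longrightarrow> F * G \<in> poly_fun"

definition partial :: "coord \<Rightarrow> ((coord \<Rightarrow> complex) \<Rightarrow> complex) \<Rightarrow> (coord \<Rightarrow> complex) \<Rightarrow> complex" where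
  "partial k F z = deriv (\<lambda>x. F (z(k := x))) (z k)"

definition subst_gens :: "((coord \<Rightarrow> complex) \<Rightarrow> complex) \<Rightarrow> rep \<Rightarrow> complex" where
  "subst_gens F = (\<lambda>\<rho>. F (\<lambda>k. tg k \<rho>))"

text \<open>
  \<open>b u v\<close> is the coefficient of the term \<open>\<partial>/\<partial>u \<and> \<partial>/\<partial>v\<close> of a formal sum of such terms, for
  ordered pairs \<open>(u, v)\<close>.
\<close>

type_synonym bivector = "coord \<Rightarrow> coord \<Rightarrow> rep \<Rightarrow> complex"

definition bv_term :: "(rep \<Rightarrow> complex) \<Rightarrow> coord \<Rightarrow> coord \<Rightarrow> bivector" where
  "bv_term a u v = (\<lambda>u' v'. if u' = u \<and> v' = v then a else 0)"

definition bv_scal :: "complex \<Rightarrow> bivector \<Rightarrow> bivector" where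
  "bv_scal c b = (\<lambda>u v. scal c (b u v))"

definition bv_bracket ::
  "bivector \<Rightarrow> ((coord \<Rightarrow> complex) \<Rightarrow> complex) \<Rightarrow> ((coord \<Rightarrow> complex) \<Rightarrow> complex) \<Rightarrow> rep \<Rightarrow> complex" where
  "bv_bracket b F G = (\<Sum>u\<in>UNIV. \<Sum>v\<in>UNIV. b u v *
     (subst_gens (partial u F) * subst_gens (partial v G)
      - subst_gens (partial v F) * subst_gens (partial u G)))"

text \<open>
  Every element of the coordinate ring is a polynomial in the generators; since these satisfy
  a relation, the formula is required for all polynomials representing the two arguments.
\<close>

definition is_poisson_bivector_field ::
  "((rep \<Rightarrow> complex) \<Rightarrow> (rep \<Rightarrow> complex) \<Rightarrow> (rep \<Rightarrow> complex)) \<Rightarrow> bivector \<Rightarrow> bool" where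
  "is_poisson_bivector_field br b \<longleftrightarrow>
     (\<forall>F \<in> poly_fun. \<forall>G \<in> poly_fun. br (subst_gens F) (subst_gens G) = bv_bracket b F G)"


section \<open>The dihedral group action\<close>

fun t_letter :: "letter \<Rightarrow> letter" where
  "t_letter X1 = X2"
| "t_letter X1inv = X2inv"
| "t_letter X2 = X1"
| "t_letter X2inv = X1inv"

fun i1_letter :: "letter \<Rightarrow> letter" where
  "i1_letter X1 = X1inv"
| "i1_letter X1inv = X1"
| "i1_letter X2 = X2"
| "i1_letter X2inv = X2inv"

definition ring_act :: "(letter \<Rightarrow> letter) \<Rightarrow> (rep \<Rightarrow> complex) \<Rightarrow> rep \<Rightarrow> complex" where
  "ring_act \<sigma> f = (\<lambda>\<rho>. f (letter_val \<rho> (\<sigma> X1), letter_val \<rho> (\<sigma> X2)))"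

lemma ring_act_tr_word:
  assumes "\<sigma> = t_letter \<or> \<sigma> = i1_letter"
  shows "ring_act \<sigma> (tr_word w) = tr_word (map \<sigma> w)"
proof -
  have "letter_val (letter_val \<rho> (\<sigma> X1), letter_val \<rho> (\<sigma> X2)) l = letter_val \<rho> (\<sigma> l)" for \<rho> l
    using assms by (cases l) (auto simp: sl3_inv_inv)
  then have "word_mat (letter_val \<rho> (\<sigma> X1), letter_val \<rho> (\<sigma> X2)) w = word_mat \<rho> (map \<sigma> w)" for \<rho>
    by (induction w) auto
  then show ?thesis
    by (simp add: ring_act_def tr_word_def)
qed

text \<open>
  The induced permutations of \<open>{t\<^sub>(\<^sub>\<plusminus>\<^sub>i\<^sub>) | 1 \<le> i \<le> 4}\<close>, see \<open>ring_act_tg\<close>. The value at \<open>Z5\<close>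
  is a dummy: \<open>t\<^sub>(\<^sub>5\<^sub>)\<close> is not mapped to a generator, and the operators below are applied only
  to bi-vectors without components in that direction.
\<close>

fun t_coord :: "coord \<Rightarrow> coord" where
  "t_coord Z1 = Z2"
| "t_coord Zm1 = Zm2"
| "t_coord Z2 = Z1"
| "t_coord Zm2 = Zm1"
| "t_coord Z3 = Z3"
| "t_coord Zm3 = Zm3"
| "t_coord Z4 = Zm4"
| "t_coord Zm4 = Z4"
| "t_coord Z5 = Z5"

fun i1_coord :: "coord \<Rightarrow> coord" where
  "i1_coord Z1 = Zm1"
| "i1_coord Zm1 = Z1"
| "i1_coord Z2 = Z2"
| "i1_coord Zm2 = Zm2"
| "i1_coord Z3 = Zm4"
| "i1_coord Zm3 = Z4"
| "i1_coord Z4 = Zm3"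
| "i1_coord Zm4 = Z3"
| "i1_coord Z5 = Z5"

lemma ring_act_tg:
  assumes "k \<noteq> Z5"
  shows "ring_act t_letter (tg k) = tg (t_coord k)" "ring_act i1_letter (tg k) = tg (i1_coord k)"
proof -
  have comm: "tr_word [l, l'] = tr_word [l', l]" for l l'
    unfolding tr_word_def word_mat.simps matrix_mul_rid by (intro ext trace_mul_sym)
  show "ring_act t_letter (tg k) = tg (t_coord k)"
    using assms comm by (cases k) (auto simp: tg_def ring_act_tr_word)
  show "ring_act i1_letter (tg k) = tg (i1_coord k)"
    using assms by (cases k) (auto simp: tg_def ring_act_tr_word)
qed

definition bv_act :: "(letter \<Rightarrow> letter) \<Rightarrow> (coord \<Rightarrow> coord) \<Rightarrow> bivector \<Rightarrow> bivector" where
  "bv_act \<sigma> \<pi> b = (\<lambda>u v. ring_act \<sigma> (b (inv \<pi> u) (inv \<pi> v)))"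

lemma bv_act_term:
  assumes "bij \<pi>"
  shows "bv_act \<sigma> \<pi> (bv_term a u v) = bv_term (ring_act \<sigma> a) (\<pi> u) (\<pi> v)"
proof -
  have "inv \<pi> u' = u \<longleftrightarrow> u' = \<pi> u" for u u'
    using assms by (metis bij_inv_eq_iff)
  then show ?thesis
    by (simp add: bv_act_def bv_term_def ring_act_def fun_eq_iff)
qed

definition D_t :: "bivector \<Rightarrow> bivector" where
  "D_t = bv_act t_letter t_coord"

definition D_i1 :: "bivector \<Rightarrow> bivector" where
  "D_i1 = bv_act i1_letter i1_coord"

definition D_i2 :: "bivector \<Rightarrow> bivector" where
  "D_i2 = D_t \<circ> D_i1 \<circ> D_t"

definition D_i :: "bivector \<Rightarrow> bivector" where
  "D_i = D_i1 \<circ> D_i2"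

definition Sigma1 :: "bivector \<Rightarrow> bivector" where
  "Sigma1 b = b + D_i b - D_i1 b - D_i2 b"

definition Sigma2 :: "bivector \<Rightarrow> bivector" where
  "Sigma2 b = b + D_i b - D_t b - D_i (D_t b)"

end

theory Submission
  imports Defs
begin

text \<open>
  The bracket is a derivation in each argument, so on polynomials in the nine generators it is
  determined by its values on pairs of generators (\<open>poisson_bivector_fieldI\<close>): a formal
  bi-vector \<open>b\<close> represents it as soon as \<open>{t\<^sub>u, t\<^sub>v} = b u v - b v u\<close> for all \<open>u\<close>, \<open>v\<close>. These
  are identities between functions on representations, so the formula follows for all
  polynomials that represent the two arguments.

  The values come from geometry. Write \<open>(x, y)\<close> for angular coordinates counted in full turns,
  so that the torus is \<open>\<real>\<^sup>2/\<int>\<^sup>2\<close> and the disk sits at \<open>(1/2, 1/2)\<close>. The generators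
  \<open>t\<^sub>(\<^sub>\<plusminus>\<^sub>1\<^sub>), \<dots>, t\<^sub>(\<^sub>\<plusminus>\<^sub>4\<^sub>)\<close> are traces of the closed straight lines in the directions
  \<open>\<plusminus>(1,0)\<close>, \<open>\<plusminus>(0,1)\<close>, \<open>\<plusminus>(1,1)\<close>, \<open>\<plusminus>(1,-1)\<close>; two such lines meet in as many points as the
  absolute value of the determinant of their directions, all with the same sign (parallel ones
  are translated apart). So \<open>{t\<^sub>(\<^sub>i\<^sub>), t\<^sub>(\<^sub>-\<^sub>i\<^sub>)} = 0\<close>, the pairs \<open>(1,2)\<close>, \<open>(1,3)\<close>, \<open>(1,-3)\<close>
  give one term and \<open>(3,4)\<close> gives two. The words read off at the crossings, such as
  \<open>x\<^sub>1x\<^sub>1x\<^sub>2\<close>, are rewritten in the generators with the Cayley-Hamilton identity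
  \<open>A\<^sup>2 = tr(A) A - tr(A\<^sup>-\<^sup>1) + A\<^sup>-\<^sup>1\<close> (\<open>tr_word_square\<close>). The boundary curve is homotopic to a
  circle around the disk that misses all these lines, so \<open>t\<^sub>(\<^sub>5\<^sub>)\<close> is a Casimir function
  (\<open>bracket_Z5\<close>).

  Up to reparametrization, all homotopies are linear in the universal cover \<open>\<real>\<^sup>2\<close>. The lifts of
  the disk miss every
  strip of half-width \<open>1/3\<close> around an integral horizontal or vertical line, and these strips
  are convex; so two paths which at each time lie in a common strip are homotopic off the disk
  (\<open>homotopic_loops_common_strip\<close>).

  The remaining pairs follow by symmetry. The reflections of the torus that induce \<open>t\<close> and
  \<open>i\<^sub>1\<close> reverse the orientation, so conjugating a Goldman bracket with one of them and
  changing the sign gives a Goldman bracket again (\<open>goldman_bracket_reflect\<close>). A value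
  computed from curves is the same for every Goldman bracket; hence the bracket of generators
  is anti-equivariant (\<open>bracket_anti_equivariant\<close>), and the alternating sums \<open>\<Sigma>\<^sub>1\<close>, \<open>\<Sigma>\<^sub>2\<close> and
  \<open>\<Sigma>\<^sub>1\<Sigma>\<^sub>2/2\<close> list each pair with a nonzero bracket exactly once and with the right sign.
\<close>

section \<open>Traces of words as invariant regular functions\<close>

text \<open>
  The classical adjugate, which makes the entries of an inverse in \<open>SL(3)\<close> polynomial.
\<close>

definition adj3 :: "complex^3^3 \<Rightarrow> complex^3^3" where
  "adj3 A = vector
     [vector [A$2$2 * A$3$3 - A$2$3 * A$3$2, A$1$3 * A$3$2 - A$1$2 * A$3$3, A$1$2 * A$2$3 - A$1$3 * A$2$2],
      vector [A$2$3 * A$3$1 - A$2$1 * A$3$3, A$1$1 * A$3$3 - A$1$3 * A$3$1, A$1$3 * A$2$1 - A$1$1 * A$2$3],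
      vector [A$2$1 * A$3$2 - A$2$2 * A$3$1, A$1$2 * A$3$1 - A$1$1 * A$3$2, A$1$1 * A$2$2 - A$1$2 * A$2$1]]"

lemma mult_adj3: "A ** adj3 A = mat (det A)"
  by (simp add: vec_eq_iff forall_3 matrix_matrix_mult_def sum_3 adj3_def det_3 mat_def algebra_simps)

lemma matrix_inv_sl3: "matrix_inv (Rep_sl3 A) = adj3 (Rep_sl3 A)"
  by (metis mult_adj3 det_Rep_sl3 matrix_inv_Rep_sl3(2) matrix_mul_assoc matrix_mul_lid matrix_mul_rid)

lemma cayley_hamilton3:
  "A ** A = (\<chi> i j. trace A * A$i$j - trace (adj3 A) * (mat 1 :: complex^3^3)$i$j + adj3 A$i$j)"
  by (simp add: vec_eq_iff forall_3 matrix_matrix_mult_def sum_3 adj3_def mat_def trace_def algebra_simps)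

text \<open>
  The Cayley-Hamilton identity \<open>A\<^sup>2 = tr(A) A - tr(A\<^sup>-\<^sup>1) + A\<^sup>-\<^sup>1\<close> of \<open>SL(3)\<close>, multiplied by
  \<open>B\<close>: it removes squares from traces of words.
\<close>

lemma trace_square_mult:
  fixes B :: "complex^3^3"
  shows "trace (Rep_sl3 A ** Rep_sl3 A ** B) =
    trace (Rep_sl3 A) * trace (Rep_sl3 A ** B) - trace (Rep_sl3 (sl3_inv A)) * trace B
      + trace (Rep_sl3 (sl3_inv A) ** B)"
  unfolding cayley_hamilton3 Rep_sl3_inv matrix_inv_sl3
  by (simp add: trace_def matrix_matrix_mult_def sum_3 mat_def algebra_simps)

lemma regular_uminus: "f \<in> regular \<Longrightarrow> - f \<in> regular"
proof -
  assume "f \<in> regular"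
  with regular.const have "(\<lambda>_. -1) * f \<in> regular"
    by (rule regular.mult)
  also have "(\<lambda>_. -1) * f = - f"
    by (simp add: fun_eq_iff)
  finally show ?thesis .
qed


lemma regular_diff: "f \<in> regular \<Longrightarrow> g \<in> regular \<Longrightarrow> f - g \<in> regular"
  using regular.add[OF _ regular_uminus, of f g] by simp

lemma regular_pointwise:
  shows "f \<in> regular \<Longrightarrow> g \<in> regular \<Longrightarrow> (\<lambda>\<rho>. f \<rho> + g \<rho>) \<in> regular"
    and "f \<in> regular \<Longrightarrow> g \<in> regular \<Longrightarrow> (\<lambda>\<rho>. f \<rho> - g \<rho>) \<in> regular"
    and "f \<in> regular \<Longrightarrow> g \<in> regular \<Longrightarrow> (\<lambda>\<rho>. f \<rho> * g \<rho>) \<in> regular"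
    and "f \<in> regular \<Longrightarrow> (\<lambda>\<rho>. - f \<rho>) \<in> regular"
  using regular.add[of f g] regular_diff[of f g] regular.mult[of f g] regular_uminus[of f]
  by (simp_all add: plus_fun_def fun_diff_def times_fun_def fun_Compl_def)

lemma regular_adj3:
  assumes "\<And>i j. (\<lambda>\<rho>. M \<rho> $ i $ j) \<in> regular"
  shows "(\<lambda>\<rho>. adj3 (M \<rho>) $ i $ j) \<in> regular"
proof -
  have "\<forall>i j. (\<lambda>\<rho>. adj3 (M \<rho>) $ i $ j) \<in> regular"
    by (simp add: forall_3 adj3_def assms regular_pointwise)
  then show ?thesis by blast
qed

lemma regular_letter: "(\<lambda>\<rho>. Rep_sl3 (letter_val \<rho> l) $ i $ j) \<in> regular"
  by (cases l) (simp_all add: Rep_sl3_inv matrix_inv_sl3 regular_adj3 regular.entry1 regular.entry2)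

lemma regular_word: "(\<lambda>\<rho>. word_mat \<rho> w $ i $ j) \<in> regular"
proof (induction w arbitrary: i j)
  case Nil
  show ?case by (simp add: regular.const)
next
  case (Cons l w)
  then show ?case
    by (simp add: matrix_matrix_mult_def sum_3 regular_pointwise regular_letter)
qed

lemma letter_val_conjugate:
  "Rep_sl3 (letter_val (conjugate g \<rho>) l) =
     Rep_sl3 g ** Rep_sl3 (letter_val \<rho> l) ** Rep_sl3 (sl3_inv g)"
proof -
  have inv: "Rep_sl3 (sl3_inv (sl3_times g (sl3_times A (sl3_inv g)))) =
      Rep_sl3 g ** Rep_sl3 (sl3_inv A) ** Rep_sl3 (sl3_inv g)" for A
  proof -
    define G H M N where GH: "G = Rep_sl3 g" "H = Rep_sl3 (sl3_inv g)" "M = Rep_sl3 A" "N = Rep_sl3 (sl3_inv A)"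
    have 1: "G ** H = mat 1" "H ** G = mat 1" "M ** N = mat 1" "N ** M = mat 1"
      by (simp_all add: GH Rep_sl3_inv matrix_inv_Rep_sl3)
    define P where "P = Rep_sl3 (sl3_times g (sl3_times A (sl3_inv g)))"
    have P: "P = G ** M ** H"
      by (simp add: P_def GH Rep_sl3_times matrix_mul_assoc)
    have "P ** (G ** N ** H) = G ** M ** (H ** G) ** N ** H"
      by (simp add: P matrix_mul_assoc)
    also have "\<dots> = G ** (M ** N) ** H"
      by (simp only: 1(2) matrix_mul_rid matrix_mul_assoc)
    also have "\<dots> = mat 1" by (simp add: 1)
    finally have PQ: "P ** (G ** N ** H) = mat 1" .
    have "matrix_inv P = matrix_inv P ** (P ** (G ** N ** H))"
      by (simp add: PQ)
    also have "\<dots> = G ** N ** H"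
      by (simp only: P_def matrix_inv_Rep_sl3 matrix_mul_lid matrix_mul_assoc)
    finally have "matrix_inv P = G ** N ** H" .
    then show ?thesis by (simp add: GH P_def Rep_sl3_inv)
  qed
  show ?thesis
    by (cases l) (simp_all add: conjugate_def inv Rep_sl3_times matrix_mul_assoc)
qed

lemma word_mat_conjugate:
  "word_mat (conjugate g \<rho>) w = Rep_sl3 g ** word_mat \<rho> w ** Rep_sl3 (sl3_inv g)"
proof (induction w)
  case Nil
  show ?case by (simp add: Rep_sl3_inv matrix_inv_Rep_sl3)
next
  case (Cons l w)
  define G H where GH: "G = Rep_sl3 g" "H = Rep_sl3 (sl3_inv g)"
  have 1: "H ** G = mat 1" by (simp add: GH Rep_sl3_inv matrix_inv_Rep_sl3)
  have "word_mat (conjugate g \<rho>) (l # w) =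
      G ** Rep_sl3 (letter_val \<rho> l) ** (H ** G) ** word_mat \<rho> w ** H"
    by (simp add: Cons GH letter_val_conjugate matrix_mul_assoc)
  also have "\<dots> = G ** word_mat \<rho> (l # w) ** H"
    unfolding 1 by (simp add: matrix_mul_assoc)
  finally show ?case by (simp only: GH)
qed

lemma tr_word_char_ring: "tr_word w \<in> char_ring"
proof -
  have "tr_word w \<in> regular"
    unfolding tr_word_def trace_def sum_3 by (intro regular_pointwise(1) regular_word)
  moreover have "tr_word w (conjugate g \<rho>) = tr_word w \<rho>" for g \<rho>
  proof -
    have "trace (Rep_sl3 g ** word_mat \<rho> w ** Rep_sl3 (sl3_inv g)) =
        trace (Rep_sl3 (sl3_inv g) ** Rep_sl3 g ** word_mat \<rho> w)"
      by (subst trace_mul_sym) (simp add: matrix_mul_assoc)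
    then show ?thesis
      by (simp add: tr_word_def word_mat_conjugate Rep_sl3_inv matrix_inv_Rep_sl3)
  qed
  ultimately show ?thesis by (simp add: char_ring_def)
qed

lemma tg_char_ring: "tg k \<in> char_ring"
  by (simp add: tg_def tr_word_char_ring)

lemma char_ring_const: "(\<lambda>\<rho>. c) \<in> char_ring"
  by (simp add: char_ring_def regular.const)

lemma char_ring_add:
  assumes "f \<in> char_ring" "g \<in> char_ring"
  shows "f + g \<in> char_ring"
  using assms regular.add[of f g] by (simp add: char_ring_def)

lemma char_ring_mult:
  assumes "f \<in> char_ring" "g \<in> char_ring"
  shows "f * g \<in> char_ring"
  using assms regular.mult[of f g] by (simp add: char_ring_def)

lemma char_ring_uminus:
  assumes "f \<in> char_ring"
  shows "- f \<in> char_ring"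
  using assms regular_uminus[of f] by (simp add: char_ring_def)

section \<open>The action of automorphisms on functions\<close>

lemma ring_act_hom:
  shows ring_act_add: "ring_act \<sigma> (f + g) = ring_act \<sigma> f + ring_act \<sigma> g"
    and ring_act_diff: "ring_act \<sigma> (f - g) = ring_act \<sigma> f - ring_act \<sigma> g"
    and ring_act_mult: "ring_act \<sigma> (f * g) = ring_act \<sigma> f * ring_act \<sigma> g"
    and ring_act_uminus: "ring_act \<sigma> (- f) = - ring_act \<sigma> f"
    and ring_act_scal: "ring_act \<sigma> (scal c f) = scal c (ring_act \<sigma> f)"
    and ring_act_0: "ring_act \<sigma> 0 = 0"
  by (simp_all add: ring_act_def scal_def fun_eq_iff)

lemma ring_act_sum: "ring_act \<sigma> (sum h S) = (\<Sum>x\<in>S. ring_act \<sigma> (h x))"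
proof -
  have "ring_act \<sigma> 0 = 0" by (simp add: ring_act_def fun_eq_iff)
  then show ?thesis by (induction S rule: infinite_finite_induct) (simp_all add: ring_act_add)
qed

lemma ring_act_ring_act:
  assumes "\<sigma> = t_letter \<or> \<sigma> = i1_letter"
  shows "ring_act \<sigma> (ring_act \<sigma> f) = f"
  using assms by (auto simp: ring_act_def fun_eq_iff sl3_inv_inv)

text \<open>
  Replacing the two matrices by words in them commutes with simultaneous conjugation.
\<close>

lemma ring_act_char_ring:
  assumes "\<sigma> = t_letter \<or> \<sigma> = i1_letter" and f: "f \<in> char_ring"
  shows "ring_act \<sigma> f \<in> char_ring"
proof -
  have reg: "ring_act \<sigma> h \<in> regular" if "h \<in> regular" for h
    using that
  proof (induction rule: regular.induct)
    case (const c)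
    show ?case by (simp add: ring_act_def regular.const)
  next
    case (entry1 i j)
    show ?case by (simp add: ring_act_def regular_letter)
  next
    case (entry2 i j)
    show ?case by (simp add: ring_act_def regular_letter)
  next
    case (add f g)
    then show ?case by (simp only: ring_act_add regular.add)
  next
    case (mult f g)
    then show ?case by (simp only: ring_act_mult regular.mult)
  qed
  have "(letter_val (conjugate g \<rho>) (\<sigma> X1), letter_val (conjugate g \<rho>) (\<sigma> X2)) =
      conjugate g (letter_val \<rho> (\<sigma> X1), letter_val \<rho> (\<sigma> X2))" for g \<rho>
    by (simp add: conjugate_def[of g "(_, _)"] Rep_sl3_inject[symmetric] letter_val_conjugate
        Rep_sl3_times matrix_mul_assoc)
  then have "ring_act \<sigma> f (conjugate g \<rho>) = f (conjugate g (letter_val \<rho> (\<sigma> X1), letter_val \<rho> (\<sigma> X2)))" for g \<rho>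
    by (simp only: ring_act_def)
  with f have "ring_act \<sigma> f (conjugate g \<rho>) = ring_act \<sigma> f \<rho>" for g \<rho>
    by (simp add: char_ring_def ring_act_def[of \<sigma> f])
  moreover have "ring_act \<sigma> f \<in> regular"
    using f by (intro reg) (simp add: char_ring_def)
  ultimately show ?thesis by (simp add: char_ring_def)
qed

section \<open>Homotopies of loops in the one-holed torus\<close>

text \<open>
  The universal covering of the torus, with angles counted in full turns: integral
  translations are the deck transformations.
\<close>

definition torus_pt :: "real \<times> real \<Rightarrow> complex \<times> complex" where
  "torus_pt p = (cis (2 * pi * fst p), cis (2 * pi * snd p))"

lemma cis_2pi_eq_iff: "cis (2 * pi * x) = cis (2 * pi * y) \<longleftrightarrow> x - y \<in> \<int>"
proof -
  have "cis (2 * pi * x) = cis (2 * pi * y) \<longleftrightarrow> (\<exists>n::int. 2 * pi * x = 2 * pi * y + 2 * pi * n)"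
    using sin_cos_eq_iff[of "2 * pi * x" "2 * pi * y"] by (auto simp: complex_eq_iff)
  also have "\<dots> \<longleftrightarrow> (\<exists>n::int. x - y = of_int n)"
  proof -
    have "2 * pi * x = 2 * pi * y + 2 * pi * n \<longleftrightarrow> x - y = n" for n :: real
    proof -
      have "2 * pi * x = 2 * pi * y + 2 * pi * n \<longleftrightarrow> 2 * pi * (x - y) = 2 * pi * n"
        by (simp add: algebra_simps)
      then show ?thesis by simp
    qed
    then show ?thesis by simp
  qed
  finally show ?thesis by (auto simp: Ints_def)
qed

lemma torus_pt_eq_iff:
  "torus_pt p = torus_pt q \<longleftrightarrow> fst p - fst q \<in> \<int> \<and> snd p - snd q \<in> \<int>"
  by (simp add: torus_pt_def cis_2pi_eq_iff)

lemma continuous_on_torus_pt [continuous_intros]: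
  "continuous_on S f \<Longrightarrow> continuous_on S (\<lambda>x. torus_pt (f x))"
  unfolding torus_pt_def cis_conv_exp by (intro continuous_intros)

text \<open>
  The removed disk lifts to disks around the points of \<open>(1/2, 1/2) + \<int>\<^sup>2\<close> of horizontal and
  vertical radius \<open>1/6\<close>. A strip of half-width \<open>1/3\<close> around an integral horizontal or vertical
  line just touches them; being convex, it contains the segment between any two of its points.
\<close>

definition common_strip :: "real \<times> real \<Rightarrow> real \<times> real \<Rightarrow> bool" where
  "common_strip p q \<longleftrightarrow>
     (\<exists>n::int. {fst p, fst q} \<subseteq> {n - 1/3..n + 1/3} \<or> {snd p, snd q} \<subseteq> {n - 1/3..n + 1/3})"

lemma common_stripI:
  fixes m n :: int
  assumes "{snd p, snd q} \<subseteq> {n - 1/3..n + 1/3} \<or> {fst p, fst q} \<subseteq> {m - 1/3..m + 1/3}"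
  shows "common_strip p q"
  using assms unfolding common_strip_def by blast

lemma cos_ge_minus_half:
  fixes n :: int
  assumes "x \<in> {n - 1/3..n + 1/3}"
  shows "cos (2 * pi * x) \<ge> -1/2"
proof -
  have "cos (2 * pi * x) = cos (2 * pi * x + 2 * pi * of_int (- n))"
    by (metis sin_cos_eq_iff)
  also have "\<dots> = cos \<bar>2 * pi * (x - of_int n)\<bar>"
    by (simp only: cos_abs_real) (simp add: algebra_simps)
  also have "\<bar>2 * pi * (x - of_int n)\<bar> = 2 * pi * \<bar>x - of_int n\<bar>"
    by (simp add: abs_mult)
  also have "cos (2 * pi * \<bar>x - of_int n\<bar>) \<ge> cos (2 * pi / 3)"
  proof (rule cos_monotone_0_pi_le)
    show "2 * pi * \<bar>x - of_int n\<bar> \<le> 2 * pi / 3"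
    proof -
      have "\<bar>x - of_int n\<bar> \<le> 1/3" using assms by (auto simp: abs_if)
      then show ?thesis using mult_left_mono[of "\<bar>x - of_int n\<bar>" "1/3" "2 * pi"] by simp
    qed
  qed simp_all
  finally show ?thesis by (simp add: cos_120)
qed

lemma cmod_cis_plus_1: "(cmod (cis a + 1))\<^sup>2 = 2 + 2 * cos a"
proof -
  have "(cmod (cis a + 1))\<^sup>2 = (cos a)\<^sup>2 + (sin a)\<^sup>2 + 1 + 2 * cos a"
    by (simp add: cmod_power2 power2_sum)
  then show ?thesis by simp
qed

text \<open>
  With the angles \<open>a\<close>, \<open>b\<close>, the squared distance from the center of the disk is
  \<open>4 + 2 cos a + 2 cos b\<close>. In a strip one of the cosines is at least \<open>-1/2\<close>, and the other one
  is at least \<open>-1\<close>.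
\<close>

lemma torus_pt_in_one_holed_torus:
  assumes "common_strip p p"
  shows "torus_pt p \<in> one_holed_torus"
proof -
  have "-1/2 \<le> cos (2 * pi * fst p) \<or> -1/2 \<le> cos (2 * pi * snd p)"
    using assms cos_ge_minus_half unfolding common_strip_def by blast
  moreover have "(dist (-1, -1) (torus_pt p))\<^sup>2
      = (cmod (cis (2 * pi * fst p) + 1))\<^sup>2 + (cmod (cis (2 * pi * snd p) + 1))\<^sup>2"
  proof -
    have "dist (-1) c = cmod (c + 1)" for c
      by (metis dist_commute dist_norm diff_minus_eq_add)
    then show ?thesis
      by (simp add: torus_pt_def dist_Pair_Pair)
  qed
  then have "(dist (-1, -1) (torus_pt p))\<^sup>2
      = 4 + 2 * cos (2 * pi * fst p) + 2 * cos (2 * pi * snd p)"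
    by (simp add: cmod_cis_plus_1)
  moreover have "cos (2 * pi * fst p) \<ge> -1" "cos (2 * pi * snd p) \<ge> -1"
    by (rule cos_ge_minus_one)+
  ultimately have "1 \<le> (dist (-1, -1) (torus_pt p))\<^sup>2"
    by linarith
  then have "\<not> dist (-1, -1) (torus_pt p) < 1"
    using power_strict_mono[of "dist (-1, -1) (torus_pt p)" 1 2] by auto
  then show ?thesis
    by (auto simp: one_holed_torus_def torus_pt_def)
qed

lemma common_strip_segment:
  assumes "common_strip p q" and "s \<in> {0..1}"
  shows "common_strip ((1 - s) *\<^sub>R p + s *\<^sub>R q) ((1 - s) *\<^sub>R p + s *\<^sub>R q)"
proof -
  have "(1 - s) * x + s * y \<in> {l..u}" if "{x, y} \<subseteq> {l..u}" for x y l u :: real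
    using that assms(2) convexD_alt[OF convex_closed_interval[of l u], of x y s] by auto
  with assms(1) show ?thesis
    unfolding common_strip_def by (simp del: atLeastAtMost_iff) blast
qed

text \<open>
  The linear homotopy in the cover projects to the one-holed torus; it stays a homotopy of
  loops because both lifts have the same displacement.
\<close>

lemma homotopic_loops_common_strip:
  assumes "path f" "path g"
    and close: "f 1 - f 0 = g 1 - g 0" "torus_pt (f 1) = torus_pt (f 0)"
    and strip: "\<And>t. t \<in> {0..1} \<Longrightarrow> common_strip (f t) (g t)"
  shows "homotopic_loops one_holed_torus (torus_pt \<circ> f) (torus_pt \<circ> g)"
proof -
  let ?h = "\<lambda>(s, t). torus_pt ((1 - s) *\<^sub>R f t + s *\<^sub>R g t)"
  have cf: "continuous_on {0..1} f" "continuous_on {0..1} g"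
    using assms(1,2) by (auto simp: path_def)
  have "continuous_on ({0..1} \<times> {0..1}) (\<lambda>p. f (snd p))" "continuous_on ({0..1} \<times> {0..1}) (\<lambda>p. g (snd p))"
    by (intro continuous_on_compose2[OF cf(1)] continuous_on_compose2[OF cf(2)] continuous_intros; auto)+
  then have "continuous_on ({0..1} \<times> {0..1}) ?h"
    unfolding case_prod_beta by (intro continuous_intros)
  moreover have "?h \<in> {0..1} \<times> {0..1} \<rightarrow> one_holed_torus"
    using strip by (auto intro!: torus_pt_in_one_holed_torus common_strip_segment)
  moreover have "pathfinish (?h \<circ> Pair s) = pathstart (?h \<circ> Pair s)" for s
  proof -
    have eq: "(1 - s) *\<^sub>R f 1 + s *\<^sub>R g 1 - ((1 - s) *\<^sub>R f 0 + s *\<^sub>R g 0) = f 1 - f 0"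
    proof -
      have "g 1 = g 0 + (f 1 - f 0)" using close(1) by simp
      then show ?thesis by (simp only:) (simp add: algebra_simps)
    qed
    have "fst (f 1 - f 0) \<in> \<int>" "snd (f 1 - f 0) \<in> \<int>"
      using close(2) by (simp_all add: torus_pt_eq_iff)
    then show ?thesis
      unfolding eq[symmetric] by (simp add: pathfinish_def pathstart_def torus_pt_eq_iff)
  qed
  ultimately show ?thesis
    unfolding homotopic_loops by (intro exI[of _ ?h]) auto
qed

fun letter_step :: "letter \<Rightarrow> real \<times> real" where
  "letter_step X1 = (1, 0)"
| "letter_step X1inv = (-1, 0)"
| "letter_step X2 = (0, 1)"
| "letter_step X2inv = (0, -1)"

text \<open>
  The lift of the loop of a word that starts at the origin. Its dyadic parametrization mirrors
  that of \<open>word_loop\<close>: the first letter takes half of the time, the second a quarter, and so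
  on, and the path rests at its endpoint during the last interval.
\<close>

fun word_lift :: "word \<Rightarrow> real \<Rightarrow> real \<times> real" where
  "word_lift [] t = (0, 0)"
| "word_lift (l # w) t =
     (if t \<le> 1/2 then (2 * t) *\<^sub>R letter_step l else letter_step l + word_lift w (2 * t - 1))"

lemma letter_loop_lift: "letter_loop l = (\<lambda>t. torus_pt (t *\<^sub>R letter_step l))"
proof -
  have "cis (2 * pi * (1 - t)) = cis (2 * pi * - t)" for t
    unfolding cis_2pi_eq_iff by simp
  then show ?thesis
    by (cases l) (simp_all add: fun_eq_iff torus_pt_def loop1_def loop2_def reversepath_def)
qed

lemma letter_step_Ints: "fst (letter_step l) \<in> \<int>" "snd (letter_step l) \<in> \<int>"
  by (cases l; simp)+

lemma word_loop_lift: "word_loop w = torus_pt \<circ> word_lift w"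
proof
  show "word_loop w t = (torus_pt \<circ> word_lift w) t" for t
  proof (induction w arbitrary: t)
    case Nil
    show ?case by (simp add: torus_pt_def linepath_def algebra_simps flip: scaleR_add_left)
  next
    case (Cons l w)
    then show ?case
      by (auto simp: joinpaths_def letter_loop_lift torus_pt_eq_iff letter_step_Ints)
  qed
qed

lemma word_lift_0: "word_lift w 0 = 0"
  by (cases w) (simp_all add: zero_prod_def)

lemma path_word_lift: "path (word_lift w)"
proof (induction w)
  case Nil
  show ?case by (simp add: path_def)
next
  case (Cons l w)
  have "word_lift (l # w) = (\<lambda>t. t *\<^sub>R letter_step l) +++ (\<lambda>t. letter_step l + word_lift w t)"
    by (simp add: fun_eq_iff joinpaths_def)
  moreover have "path (\<lambda>t. letter_step l + word_lift w t)"
    using Cons unfolding path_def by (intro continuous_intros)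
  moreover have "path (\<lambda>t. t *\<^sub>R letter_step l)"
    unfolding path_def by (intro continuous_intros)
  ultimately show ?case
    by (simp add: path_join_eq pathfinish_def pathstart_def word_lift_0)
qed

lemma torus_pt_word_lift_1: "torus_pt (word_lift w 1) = torus_pt (word_lift w 0)"
proof -
  have "fst (word_lift w 1) \<in> \<int> \<and> snd (word_lift w 1) \<in> \<int>"
    by (induction w) (auto simp: letter_step_Ints)
  then show ?thesis by (simp add: torus_pt_eq_iff word_lift_0)
qed

text \<open>
  The criterion by which all free homotopy classes below are identified. Comparing lifts at
  equal times turns it into linear inequalities between piecewise linear functions.
\<close>

lemma represents_lift:
  assumes "path g" "\<And>t. t \<in> {0..1} \<Longrightarrow> \<gamma> t = torus_pt (g t)"
    and "g 1 - g 0 = word_lift w 1"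
    and "\<And>t. t \<in> {0..1} \<Longrightarrow> common_strip (word_lift w t) (g t)"
  shows "represents w \<gamma>"
proof -
  have "homotopic_loops one_holed_torus (torus_pt \<circ> word_lift w) (torus_pt \<circ> g)"
    using assms by (intro homotopic_loops_common_strip path_word_lift torus_pt_word_lift_1)
      (simp_all add: word_lift_0)
  moreover have "homotopic_loops one_holed_torus (torus_pt \<circ> g) \<gamma>"
    using homotopic_loops_imp_path[OF calculation] homotopic_loops_imp_subset[OF calculation]
      homotopic_loops_imp_loop[OF calculation] assms(2)
    by (intro homotopic_loops_eq) auto
  ultimately show ?thesis
    unfolding represents_def word_loop_lift by (rule homotopic_loops_trans)
qed

section \<open>Curves given by their lifts\<close>

lemma lifted_curve_derivative:
  assumes "(x has_real_derivative x') (at s)" "(y has_real_derivative y') (at s)"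
  shows "((\<lambda>s. torus_pt (x s, y s)) has_vector_derivative
    ((2 * pi * x') *\<^sub>R (\<i> * cis (2 * pi * x s)), (2 * pi * y') *\<^sub>R (\<i> * cis (2 * pi * y s)))) (at s)"
proof -
  have "((\<lambda>s. cis (2 * pi * z s)) has_vector_derivative (2 * pi * z') *\<^sub>R (\<i> * cis (2 * pi * z s))) (at s)"
    if "(z has_real_derivative z') (at s)" for z z'
  proof -
    have "((\<lambda>s. of_real (2 * pi * z s)) has_vector_derivative of_real (2 * pi * z')) (at s)"
      using that by (intro has_vector_derivative_of_real DERIV_cmult)
    then have "((\<lambda>s. \<i> * of_real (2 * pi * z s)) has_vector_derivative \<i> * of_real (2 * pi * z')) (at s)"
      by (rule has_vector_derivative_mult_right)
    from field_vector_diff_chain_at[OF this DERIV_exp] show ?thesis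
      by (simp add: o_def cis_conv_exp scaleR_conv_of_real mult_ac)
  qed
  then show ?thesis
    unfolding torus_pt_def fst_conv snd_conv using assms by (intro has_vector_derivative_Pair)
qed

locale smooth_lift =
  fixes x y x' y' :: "real \<Rightarrow> real"
  assumes derivs: "\<And>s. (x has_real_derivative x' s) (at s)" "\<And>s. (y has_real_derivative y' s) (at s)"
begin

definition curve :: "real \<Rightarrow> complex \<times> complex" where
  "curve s = torus_pt (x s, y s)"

lemma vector_derivative_curve:
  "(curve has_vector_derivative
    ((2 * pi * x' s) *\<^sub>R (\<i> * cis (2 * pi * x s)), (2 * pi * y' s) *\<^sub>R (\<i> * cis (2 * pi * y s)))) (at s)"
  unfolding curve_def by (rule lifted_curve_derivative[OF derivs])

lemma angular_velocity_curve:
  "angular_velocity1 curve s = 2 * pi * x' s" "angular_velocity2 curve s = 2 * pi * y' s"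
proof -
  have "Im (cnj (cis a) * (r *\<^sub>R (\<i> * cis a))) = r" for a r
  proof -
    have "cnj (cis a) * (r *\<^sub>R (\<i> * cis a)) = r *\<^sub>R (\<i> * (cis a * cnj (cis a)))"
      by (simp add: scaleR_conv_of_real mult_ac)
    then show ?thesis by (simp add: cis_cnj cis_mult)
  qed
  then show "angular_velocity1 curve s = 2 * pi * x' s" "angular_velocity2 curve s = 2 * pi * y' s"
    unfolding angular_velocity1_def angular_velocity2_def vector_derivative_at[OF vector_derivative_curve]
    by (simp_all add: curve_def torus_pt_def)
qed

text \<open>
  By periodicity the whole curve is traced on \<open>[0, 1]\<close>, and there a curve which represents a
  word lies in the one-holed torus because it is the end of a homotopy inside it.
\<close>

lemma immersed_curve:
  assumes "continuous_on UNIV x'" "continuous_on UNIV y'"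
    and "\<And>s. x' s \<noteq> 0 \<or> y' s \<noteq> 0"
    and per: "\<And>s. x (s + 1) - x s \<in> \<int>" "\<And>s. y (s + 1) - y s \<in> \<int>"
    and "represents w curve"
  shows "immersed_closed_curve curve"
  unfolding immersed_closed_curve_def
proof (intro conjI allI)
  have "continuous_on UNIV x" "continuous_on UNIV y"
    using derivs by (auto intro!: continuous_at_imp_continuous_on DERIV_isCont)
  then have "continuous_on UNIV (\<lambda>s. ((2 * pi * x' s) *\<^sub>R (\<i> * cis (2 * pi * x s)), (2 * pi * y' s) *\<^sub>R (\<i> * cis (2 * pi * y s))))"
    using assms(1,2) unfolding cis_conv_exp by (intro continuous_intros)
  then show "curve C1_differentiable_on UNIV"
    unfolding C1_differentiable_on_def using vector_derivative_curve by (intro exI conjI ballI)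
  show "vector_derivative curve (at s) \<noteq> 0" for s
    using assms(3)[of s] unfolding vector_derivative_at[OF vector_derivative_curve]
    by (auto simp: zero_prod_def)
  show shift: "curve (s + 1) = curve s" for s
    using per by (simp add: curve_def torus_pt_eq_iff)
  have nat: "curve (s + real n) = curve s" for s n
    using shift[of "s + real _"] by (induction n) (simp_all add: algebra_simps)
  have frac: "curve s = curve (frac s)" for s
  proof (cases "s \<ge> 0")
    case True
    then show ?thesis using nat[of "frac s" "nat \<lfloor>s\<rfloor>"] by (simp add: frac_def)
  next
    case False
    then show ?thesis using nat[of s "nat (- \<lfloor>s\<rfloor>)"] by (simp add: frac_def algebra_simps)
  qed
  have "path_image curve \<subseteq> one_holed_torus"
    using assms(6) homotopic_loops_imp_subset unfolding represents_def by blast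
  then show "range curve \<subseteq> one_holed_torus"
    using frac frac_ge_0 frac_lt_1 by (fastforce simp: path_image_def intro: order.strict_implies_order)
qed

end

text \<open>
  Simple closed curves pass each point at most once, so only the crossings between the two
  curves have to be transverse.
\<close>

lemma generic_position_simple:
  assumes "inj_on \<alpha> {0..<1}" "inj_on \<beta> {0..<1}"
    and "\<And>s u. (s, u) \<in> crossings \<alpha> \<beta> \<Longrightarrow> tangent_det \<alpha> s \<beta> u \<noteq> 0"
  shows "generic_position \<alpha> \<beta>"
proof -
  have card: "card {s \<in> {0..<1}. \<gamma> s = p} \<le> 1" if "inj_on \<gamma> {0..<1}" for \<gamma> :: "real \<Rightarrow> complex \<times> complex" and p
  proof (cases "\<exists>s\<in>{0..<1}. \<gamma> s = p")
    case True
    then obtain s where "s \<in> {0..<1}" "\<gamma> s = p" by blast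
    then have "{s \<in> {0..<1}. \<gamma> s = p} = {s}"
      using that by (auto dest: inj_onD)
    then show ?thesis by simp
  next
    case False
    then have "{s \<in> {0..<1}. \<gamma> s = p} = {}" by blast
    then show ?thesis by (simp only: card.empty)
  qed
  have "card {s \<in> {0..<1}. \<alpha> s = p} + card {u \<in> {0..<1}. \<beta> u = p} \<le> 2" for p
    using card[OF assms(1), of p] card[OF assms(2), of p] by linarith
  moreover have "s = u" if "(s, u) \<in> crossings \<gamma> \<gamma>" "inj_on \<gamma> {0..<1}" for s u \<gamma>
    using that by (auto simp: crossings_def dest: inj_onD)
  ultimately show ?thesis
    using assms unfolding generic_position_def by blast
qed

definition line :: "int \<Rightarrow> int \<Rightarrow> real \<Rightarrow> real \<Rightarrow> real \<Rightarrow> complex \<times> complex" where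
  "line p q a b = (\<lambda>s. torus_pt (of_int p * s + a, of_int q * s + b))"

lemma smooth_lift_line: "smooth_lift (\<lambda>s. of_int p * s + a) (\<lambda>s. of_int q * s + b) (\<lambda>s. of_int p) (\<lambda>s. of_int q)"
  by unfold_locales (auto intro!: derivative_eq_intros)

lemma curve_line: "smooth_lift.curve (\<lambda>s. of_int p * s + a) (\<lambda>s. of_int q * s + b) = line p q a b"
  by (simp add: fun_eq_iff smooth_lift.curve_def[OF smooth_lift_line] line_def)

lemma tangent_det_line:
  "tangent_det (line p q a b) s (line p' q' a' b') u = (2 * pi)\<^sup>2 * of_int (p * q' - q * p')"
  unfolding tangent_det_def curve_line[symmetric] smooth_lift.angular_velocity_curve[OF smooth_lift_line]
  by (simp add: power2_eq_square algebra_simps)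

lemma immersed_line:
  assumes "represents w (line p q a b)" and "p \<noteq> 0 \<or> q \<noteq> 0"
  shows "immersed_closed_curve (line p q a b)"
  unfolding curve_line[symmetric]
proof (rule smooth_lift.immersed_curve[OF smooth_lift_line, of _ _ _ _ w])
  show "represents w (smooth_lift.curve (\<lambda>s. of_int p * s + a) (\<lambda>s. of_int q * s + b))"
    using assms by (simp only: curve_line)
qed (use assms in \<open>auto simp: algebra_simps\<close>)

lemma inj_line:
  assumes "\<bar>p\<bar> = 1 \<or> \<bar>q\<bar> = 1"
  shows "inj_on (line p q a b) {0..<1}"
proof (rule inj_onI)
  fix s u assume su: "s \<in> {0..<1}" "u \<in> {0..<1}" and "line p q a b s = line p q a b u"
  then have *: "of_int p * (s - u) \<in> \<int>" "of_int q * (s - u) \<in> \<int>"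
    by (simp_all add: line_def torus_pt_eq_iff algebra_simps)
  have "s - u \<in> \<int>"
  proof -
    have "of_int r * (s - u) \<in> \<int> \<Longrightarrow> \<bar>r\<bar> = 1 \<Longrightarrow> s - u \<in> \<int>" for r
      using Ints_minus[of "u - s"] by (cases "r = 1") (auto simp: abs_if split: if_splits)
    then show ?thesis using * assms by blast
  qed
  then obtain n where "s - u = of_int n" by (auto elim: Ints_cases)
  moreover from this su have "n = 0" by auto
  ultimately show "s = u" by simp
qed

lemma crossings_line:
  "crossings (line p q a b) (line p' q' a' b') = {(s, u). s \<in> {0..<1} \<and> u \<in> {0..<1} \<and>
     (of_int p * s + a) - (of_int p' * u + a') \<in> \<int> \<and> (of_int q * s + b) - (of_int q' * u + b') \<in> \<int>}"
  by (simp add: crossings_def line_def torus_pt_eq_iff)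

lemma generic_position_lines:
  assumes "\<bar>p\<bar> = 1 \<or> \<bar>q\<bar> = 1" "\<bar>p'\<bar> = 1 \<or> \<bar>q'\<bar> = 1"
    and "p * q' - q * p' \<noteq> 0 \<or> crossings (line p q a b) (line p' q' a' b') = {}"
  shows "generic_position (line p q a b) (line p' q' a' b')"
proof (rule generic_position_simple)
  show "inj_on (line p q a b) {0..<1}" "inj_on (line p' q' a' b') {0..<1}"
    by (rule inj_line, fact)+
  show "tangent_det (line p q a b) s (line p' q' a' b') u \<noteq> 0"
    if "(s, u) \<in> crossings (line p q a b) (line p' q' a' b')" for s u
    using assms(3) that unfolding tangent_det_line
    by (simp del: of_int_diff of_int_mult) (metis empty_iff)?
qed

lemma represents_line:
  assumes "word_lift w 1 = (of_int p, of_int q)"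
    and "\<And>t. t \<in> {0..1} \<Longrightarrow> common_strip (word_lift w t) (of_int p * t + a, of_int q * t + b)"
  shows "represents w (line p q a b)"
  using assms
  by (intro represents_lift[where g = "\<lambda>t. (of_int p * t + a, of_int q * t + b)"])
     (auto simp: line_def path_def intro!: continuous_intros)

text \<open>
  The point \<open>(x, y)\<close> is a lift of the crossing point. From there the product of the two based
  lines lifts to a broken segment; each of its two halves is compared with the lift of \<open>w\<close>.
  The choice of the lift matters: the lift of \<open>w\<close> always starts at the origin.
\<close>

lemma represents_product:
  assumes P: "x - (of_int p * s + a) \<in> \<int>" "y - (of_int q * s + b) \<in> \<int>"
      "x - (of_int p' * u + a') \<in> \<int>" "y - (of_int q' * u + b') \<in> \<int>"
    and "word_lift w 1 = (of_int (p + p'), of_int (q + q'))"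
    and "\<And>t. t \<in> {0..1/2} \<Longrightarrow>
      common_strip (word_lift w t) (x + 2 * t * of_int p, y + 2 * t * of_int q)"
    and "\<And>t. t \<in> {1/2..1} \<Longrightarrow>
      common_strip (word_lift w t) (x + of_int p + (2 * t - 1) * of_int p', y + of_int q + (2 * t - 1) * of_int q')"
  shows "represents w (based_at (line p q a b) s +++ based_at (line p' q' a' b') u)"
proof -
  define g where "g = (\<lambda>t. (x + t * of_int p, y + t * of_int q)) +++
    (\<lambda>t. (x + of_int p + t * of_int p', y + of_int q + t * of_int q'))"
  show ?thesis
  proof (rule represents_lift[where g = g])
    show "path g"
      unfolding g_def by (intro path_join_imp)
        (auto simp: path_def pathfinish_def pathstart_def intro!: continuous_intros)
    show "g 1 - g 0 = word_lift w 1"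
      using assms(5) by (simp add: g_def joinpaths_def)
    show "common_strip (word_lift w t) (g t)" if "t \<in> {0..1}" for t
      using assms(6,7)[of t] that by (simp add: g_def joinpaths_def)
    show "(based_at (line p q a b) s +++ based_at (line p' q' a' b') u) t = torus_pt (g t)" for t
    proof -
      have shift: "of_int c * (z + v) + e - (x + of_int k + v * of_int c) \<in> \<int>"
        if "x - (of_int c * z + e) \<in> \<int>" for x z v e :: real and c k :: int
      proof -
        have "of_int c * (z + v) + e - (x + of_int k + v * of_int c) = - (x - (of_int c * z + e)) - of_int k"
          by (simp add: algebra_simps)
        with that show ?thesis by (metis Ints_diff Ints_minus Ints_of_int)
      qed
      show ?thesis
        using shift[OF P(1), of "2 * t" 0] shift[OF P(2), of "2 * t" 0]
          shift[OF P(3), of "2 * t - 1" p] shift[OF P(4), of "2 * t - 1" q]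
        by (simp add: g_def joinpaths_def based_at_def line_def torus_pt_eq_iff)
    qed
  qed
qed

section \<open>Straight representatives and their crossings\<close>

lemma represents_X1: "\<bar>d\<bar> \<le> 1/3 \<Longrightarrow> represents [X1] (line 1 0 0 d)"
  by (rule represents_line) (auto intro!: common_stripI[of _ _ 0])

lemma represents_X1inv: "\<bar>d\<bar> \<le> 1/3 \<Longrightarrow> represents [X1inv] (line (-1) 0 0 d)"
  by (rule represents_line) (auto intro!: common_stripI[of _ _ 0])

lemma represents_X2: "represents [X2] (line 0 1 0 0)"
  by (rule represents_line) (auto intro!: common_stripI[of _ _ _ 0])



text \<open>
  The starting points of the diagonal lines are chosen such that, at the time at which the
  lift of the word turns from a horizontal to a vertical line, the straight line passes
  through the intersection of the corresponding strips.
\<close>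

lemma represents_X1X2: "represents [X1, X2] (line 1 1 (1/6) (-1/3))"
  by (rule represents_line) (auto intro!: common_stripI[of _ _ 0 1])

lemma represents_X1X2inv: "represents [X1, X2inv] (line 1 (-1) (1/6) (1/3))"
  by (rule represents_line) (auto intro!: common_stripI[of _ _ 0 1])

text \<open>
  This line is not the reverse of the one representing \<open>x\<^sub>1x\<^sub>2\<close>, but a translate of that
  reverse, so that the two are disjoint.
\<close>

lemma represents_X1inv_X2inv: "represents [X1inv, X2inv] (line (-1) (-1) (-1/4) (1/3))"
  by (rule represents_line) (auto intro!: common_stripI[of _ _ 0 "-1"])

lemma represents_product_1_2:
  "represents [X1, X2] (based_at (line 1 0 0 0) 0 +++ based_at (line 0 1 0 0) 0)"
  by (rule represents_product[of 0 _ _ _ 0]) (auto intro!: common_stripI[of _ _ 0 1])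

lemma represents_product_1_3:
  "represents [X1, X1, X2] (based_at (line 1 0 0 0) (1/2) +++ based_at (line 1 1 (1/6) (-1/3)) (1/3))"
proof (rule represents_product[of "1/2" _ _ _ 0])
  fix t :: real assume "t \<in> {1/2..1}"
  then consider "t \<in> {1/2..7/8}" | "t \<in> {7/8..1}" by fastforce
  then show "common_strip (word_lift [X1, X1, X2] t)
      (1/2 + of_int 1 + (2 * t - 1) * of_int 1, 0 + of_int 0 + (2 * t - 1) * of_int 1)"
  proof cases
    case 1
    then show ?thesis by (intro common_stripI[of _ _ 0 2]) auto
  next
    case 2
    then show ?thesis by (intro common_stripI[of _ _ 1 2]) auto
  qed
qed (auto intro!: common_stripI[of _ _ 0])

text \<open>
  The line for \<open>x\<^sub>1\<close> is lowered by \<open>1/6\<close> in order that the dyadic lift of the word and the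
  broken line always share a strip. The word is conjugate to \<open>x\<^sub>2\<^sup>-\<^sup>1\<close>; the strips that the
  broken line runs through dictate this conjugate.
\<close>

lemma represents_product_1_m3:
  "represents [X1, X2inv, X1inv]
     (based_at (line 1 0 0 (-1/6)) (1/4) +++ based_at (line (-1) (-1) (-1/4) (1/3)) (1/2))"
proof (rule represents_product[of "1/4" _ _ _ "-1/6"])
  fix t :: real assume "t \<in> {1/2..1}"
  then consider "t \<in> {1/2..2/3}" | "t \<in> {2/3..1}" by fastforce
  then show "common_strip (word_lift [X1, X2inv, X1inv] t)
      (1/4 + of_int 1 + (2 * t - 1) * of_int (-1), -1/6 + of_int 0 + (2 * t - 1) * of_int (-1))"
  proof cases
    case 1
    then show ?thesis by (intro common_stripI[of _ _ 0 1]) auto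
  next
    case 2
    then show ?thesis by (intro common_stripI[of _ _ "-1" 1]) auto
  qed
qed (auto intro!: common_stripI[of _ _ 0])

text \<open>
  The first of the two crossings, at \<open>(1/2, 0)\<close>; its lift \<open>(-1/2, 0)\<close> makes the broken line
  pass the same strips as the word.
\<close>

lemma represents_product_3_4_first:
  "represents [X2, X1, X2inv, X1]
     (based_at (line 1 1 (1/6) (-1/3)) (1/3) +++ based_at (line 1 (-1) (1/6) (1/3)) (1/3))"
proof (rule represents_product[of "-1/2" _ _ _ 0])
  fix t :: real assume "t \<in> {0..1/2}"
  then consider "t \<in> {0..1/4}" | "t \<in> {1/4..1/2}" by fastforce
  then show "common_strip (word_lift [X2, X1, X2inv, X1] t) (-1/2 + 2 * t * of_int 1, 0 + 2 * t * of_int 1)"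
  proof cases
    case 1
    then show ?thesis by (intro common_stripI[of _ _ 0 0]) auto
  next
    case 2
    then show ?thesis by (intro common_stripI[of _ _ 1 0]) auto
  qed
next
  fix t :: real assume "t \<in> {1/2..1}"
  then consider "t \<in> {1/2..3/4}" | "t \<in> {3/4..1}" by fastforce
  then show "common_strip (word_lift [X2, X1, X2inv, X1] t)
      (-1/2 + of_int 1 + (2 * t - 1) * of_int 1, 0 + of_int 1 + (2 * t - 1) * of_int (-1))"
  proof cases
    case 1
    then show ?thesis by (intro common_stripI[of _ _ 1 1]) auto
  next
    case 2
    then show ?thesis by (intro common_stripI[of _ _ 0 1]) auto
  qed
qed auto

text \<open>
  At the second crossing \<open>(0, 1/2)\<close> the product has the same displacement \<open>(2, 0)\<close>, but where
  it leaves the horizontal strip it stays in a vertical one, so that its excursions are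
  contracted away.
\<close>

lemma represents_product_3_4_second:
  "represents [X1, X1]
     (based_at (line 1 1 (1/6) (-1/3)) (5/6) +++ based_at (line 1 (-1) (1/6) (1/3)) (5/6))"
proof (rule represents_product[of 0 _ _ _ "-1/2"])
  fix t :: real assume "t \<in> {0..1/2}"
  then consider "t \<in> {0..1/4}" | "t \<in> {1/4..1/2}" by fastforce
  then show "common_strip (word_lift [X1, X1] t) (0 + 2 * t * of_int 1, -1/2 + 2 * t * of_int 1)"
  proof cases
    case 1
    then show ?thesis by (intro common_stripI[of _ _ 0 0]) auto
  next
    case 2
    then show ?thesis by (intro common_stripI[of _ _ 0 1]) auto
  qed
next
  fix t :: real assume "t \<in> {1/2..1}"
  then consider "t \<in> {1/2..3/4}" | "t \<in> {3/4..1}" by fastforce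
  then show "common_strip (word_lift [X1, X1] t)
      (0 + of_int 1 + (2 * t - 1) * of_int 1, -1/2 + of_int 1 + (2 * t - 1) * of_int (-1))"
  proof cases
    case 1
    then show ?thesis by (intro common_stripI[of _ _ 0 1]) auto
  next
    case 2
    then show ?thesis by (intro common_stripI[of _ _ 0 2]) auto
  qed
qed auto

lemma Ints_unit_interval:
  assumes "x - c \<in> \<int>" "x \<in> {0..<1}" "c \<in> {0..<1}"
  shows "x = (c :: real)"
proof -
  from assms(1) obtain n where "x - c = of_int n" by (auto elim: Ints_cases)
  moreover from this assms have "n = 0" by auto
  ultimately show ?thesis by simp
qed

lemma crossings_1_2: "crossings (line 1 0 0 0) (line 0 1 0 0) = {(0, 0)}"
proof -
  have "s = 0 \<and> u = 0" if "s \<in> {0..<1}" "u \<in> {0..<1}" "s \<in> \<int>" "- u \<in> \<int>" for s u :: real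
    using that Ints_unit_interval[of s 0] Ints_unit_interval[of u 0] by simp
  then show ?thesis by (auto simp: crossings_line)
qed

lemma crossings_1_3: "crossings (line 1 0 0 0) (line 1 1 (1/6) (-1/3)) = {(1/2, 1/3)}"
proof -
  have "s = 1/2 \<and> u = 1/3"
    if "s \<in> {0..<1}" "u \<in> {0..<1}" "s - (u + 1/6) \<in> \<int>" "0 - (u - 1/3) \<in> \<int>" for s u :: real
  proof -
    have "u - 1/3 \<in> \<int>" using Ints_minus[OF that(4)] by simp
    then have "u = 1/3" using that(2) by (intro Ints_unit_interval) auto
    moreover from this have "s - 1/2 = s - (u + 1/6)" by simp
    then have "s = 1/2" using that(1,3) by (intro Ints_unit_interval) (simp_all only:, auto)
    ultimately show ?thesis by simp
  qed
  then show ?thesis by (auto simp: crossings_line)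
qed

lemma crossings_1_m3:
  "crossings (line 1 0 0 (-1/6)) (line (-1) (-1) (-1/4) (1/3)) = {(1/4, 1/2)}"
proof -
  have "s = 1/4 \<and> u = 1/2"
    if "s \<in> {0..<1}" "u \<in> {0..<1}" "s - (- u - 1/4) \<in> \<int>" "-1/6 - (- u + 1/3) \<in> \<int>" for s u :: real
  proof -
    have u: "u = 1/2" using that(2,4) by (intro Ints_unit_interval) (auto simp: algebra_simps)
    have "s - 1/4 = s - (- u - 1/4) - 1" by (simp add: u)
    then have "s - 1/4 \<in> \<int>" using that(3) by (simp only: Ints_diff Ints_1)
    then have "s = 1/4" using that(1) by (intro Ints_unit_interval) auto
    with u show ?thesis by simp
  qed
  then show ?thesis by (auto simp: crossings_line)
qed

lemma crossings_3_4:
  "crossings (line 1 1 (1/6) (-1/3)) (line 1 (-1) (1/6) (1/3)) = {(1/3, 1/3), (5/6, 5/6)}"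
proof -
  have "s = u \<and> (u = 1/3 \<or> u = 5/6)"
    if "s \<in> {0..<1}" "u \<in> {0..<1}" "s - u \<in> \<int>" "s - 1/3 - (- u + 1/3) \<in> \<int>" for s u :: real
  proof -
    have su: "s = u" using that by (intro Ints_unit_interval)
    from that(4) obtain n where n: "s - 1/3 - (- u + 1/3) = of_int n" by (auto elim: Ints_cases)
    with su that(1) have "n = 0 \<or> n = 1" by auto
    with n su show ?thesis by auto
  qed
  note diagonal = this
  show ?thesis
  proof (intro equalityI subsetI)
    fix p assume "p \<in> crossings (line 1 1 (1/6) (-1/3)) (line 1 (-1) (1/6) (1/3))"
    then show "p \<in> {(1/3, 1/3), (5/6, 5/6)}"
      using diagonal[of "fst p" "snd p"] by (auto simp: crossings_line prod_eq_iff)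
  qed (auto simp: crossings_line)
qed

lemma crossings_1_m1: "crossings (line 1 0 0 0) (line (-1) 0 0 (1/4)) = {}"
proof -
  have "- (1/4) \<notin> (\<int> :: real set)"
    using Ints_unit_interval[of 0 "1/4"] by auto
  then show ?thesis by (auto simp: crossings_line)
qed

lemma crossings_3_m3: "crossings (line 1 1 (1/6) (-1/3)) (line (-1) (-1) (-1/4) (1/3)) = {}"
proof -
  have False if "s + 1/6 - (- u - 1/4) \<in> \<int>" "s - 1/3 - (- u + 1/3) \<in> \<int>" for s u :: real
  proof -
    \<comment> \<open>on these lines \<open>x - y\<close> is congruent to \<open>1/2\<close> and to \<open>5/12\<close>, respectively\<close>
    have "1/12 - 0 = (s + 1/6 - (- u - 1/4)) - (s - 1/3 - (- u + 1/3)) - 1" by simp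
    then have "1/12 - 0 \<in> (\<int> :: real set)" using that by (simp only: Ints_diff Ints_1)
    then have "1/12 = (0::real)" by (rule Ints_unit_interval) auto
    then show False by simp
  qed
  then show ?thesis by (auto simp: crossings_line)
qed

section \<open>The boundary curve\<close>

text \<open>
  For the boundary curve a circle of constant speed has to be compared with the dyadic
  parametrization of a word of length four.
\<close>

lemma represents_reparametrize:
  assumes "represents w (\<gamma> \<circ> f)"
    and "path \<gamma>" "path_image \<gamma> \<subseteq> one_holed_torus" "pathfinish \<gamma> = pathstart \<gamma>"
    and "continuous_on {0..1} f" "f \<in> {0..1} \<rightarrow> {0..1}" "f 0 = 0" "f 1 = 1"
  shows "represents w \<gamma>"
proof -
  have "homotopic_paths one_holed_torus \<gamma> (\<gamma> \<circ> f)"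
    using assms by (intro homotopic_paths_reparametrize[where f = f]) auto
  then have "homotopic_loops one_holed_torus \<gamma> (\<gamma> \<circ> f)"
    using assms(4,8) by (intro homotopic_paths_imp_homotopic_loops) (simp_all add: pathstart_def pathfinish_def)
  with assms(1) show ?thesis
    unfolding represents_def using homotopic_loops_trans homotopic_loops_sym by blast
qed

text \<open>
  The boundary curve is the circle of radius \<open>1/4\<close> around \<open>(1/2, 1/2)\<close>, traversed
  counterclockwise. It starts on the diagonal towards the origin, so that its four quarters
  face the four sides of the unit square. The radius must be at least \<open>\<surd>2/6\<close> for the diagonal
  points to lie in strips, and less than \<open>\<surd>2/4\<close> for the circle to miss the lines
  \<open>x - y \<in> 1/2 + \<int>\<close>.
\<close>

definition boundary_angle :: "real \<Rightarrow> real" where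
  "boundary_angle s = 2 * pi * s - 3 * pi / 4"

definition boundary_x :: "real \<Rightarrow> real" where
  "boundary_x s = 1/2 + cos (boundary_angle s) / 4"

definition boundary_y :: "real \<Rightarrow> real" where
  "boundary_y s = 1/2 + sin (boundary_angle s) / 4"

lemma boundary_periodic: "boundary_x (s + 1) = boundary_x s" "boundary_y (s + 1) = boundary_y s"
proof -
  have "boundary_angle (s + 1) = boundary_angle s + 2 * pi"
    by (simp add: boundary_angle_def algebra_simps)
  then show "boundary_x (s + 1) = boundary_x s" "boundary_y (s + 1) = boundary_y s"
    by (simp_all add: boundary_x_def boundary_y_def)
qed

lemma boundary_range: "boundary_x s \<in> {1/4..3/4}" "boundary_y s \<in> {1/4..3/4}"
  unfolding boundary_x_def boundary_y_def atLeastAtMost_iff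
  using cos_le_one[of "boundary_angle s"] cos_ge_minus_one[of "boundary_angle s"]
    sin_le_one[of "boundary_angle s"] sin_ge_minus_one[of "boundary_angle s"]
  by (intro conjI; linarith)+

definition boundary_loop :: "real \<Rightarrow> complex \<times> complex" where
  "boundary_loop s = torus_pt (boundary_x s, boundary_y s)"

lemma smooth_lift_boundary:
  "smooth_lift boundary_x boundary_y
     (\<lambda>s. - (pi / 2) * sin (boundary_angle s)) (\<lambda>s. (pi / 2) * cos (boundary_angle s))"
  by unfold_locales
    (auto intro!: derivative_eq_intros simp: boundary_x_def [abs_def] boundary_y_def [abs_def] boundary_angle_def)

lemma curve_boundary: "smooth_lift.curve boundary_x boundary_y = boundary_loop"
  by (simp add: fun_eq_iff smooth_lift.curve_def[OF smooth_lift_boundary] boundary_loop_def)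

lemma cos_ge_two_thirds:
  assumes "\<bar>a\<bar> \<le> pi / 4"
  shows "cos a \<ge> 2/3"
proof -
  have "2/3 \<le> sqrt 2 / 2"
    using real_le_rsqrt[of "4/3" 2] by (simp add: power2_eq_square)
  also have "\<dots> = cos (pi / 4)" by (simp add: cos_45)
  also have "\<dots> \<le> cos \<bar>a\<bar>"
    using assms by (intro cos_monotone_0_pi_le) auto
  finally show ?thesis by simp
qed

lemma boundary_in_strip:
  "s \<in> {0..1/4} \<Longrightarrow> boundary_y s \<in> {1/4..1/3}"
  "s \<in> {1/4..1/2} \<Longrightarrow> boundary_x s \<in> {2/3..3/4}"
  "s \<in> {1/2..3/4} \<Longrightarrow> boundary_y s \<in> {2/3..3/4}"
  "s \<in> {3/4..1} \<Longrightarrow> boundary_x s \<in> {1/4..1/3}"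
proof -
  \<comment> \<open>\<open>r\<close> is the angle of the middle of the quarter that starts at the parameter \<open>l\<close>\<close>
  have side: "cos (boundary_angle s - r) \<in> {2/3..1}"
    if "s \<in> {l..l + 1/4}" "r = 2 * pi * (l + 1/8) - 3 * pi / 4" for l r
  proof -
    have "boundary_angle s - r = 2 * pi * (s - (l + 1/8))"
      by (simp add: boundary_angle_def that(2) algebra_simps)
    moreover have "\<bar>s - (l + 1/8)\<bar> \<le> 1/8"
      using that(1) by (auto simp: abs_if)
    ultimately have "\<bar>boundary_angle s - r\<bar> \<le> pi / 4"
      using mult_left_mono[of "\<bar>s - (l + 1/8)\<bar>" "1/8" "2 * pi"] by (simp add: abs_mult)
    from cos_ge_two_thirds[OF this] show ?thesis by simp
  qed
  have *: "cos (a - pi) = - cos a" "cos (a - - (pi / 2)) = - sin a" "cos (a - pi / 2) = sin a"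
    "cos (a + pi / 2) = - sin a" for a
    by (simp_all add: cos_diff cos_add)
  show "s \<in> {0..1/4} \<Longrightarrow> boundary_y s \<in> {1/4..1/3}"
    using side[of 0 "- (pi/2)"] boundary_range(2)[of s] by (auto simp: * boundary_y_def)
  show "s \<in> {1/4..1/2} \<Longrightarrow> boundary_x s \<in> {2/3..3/4}"
    using side[of "1/4" 0] boundary_range(1)[of s] by (simp add: boundary_x_def)
  show "s \<in> {1/2..3/4} \<Longrightarrow> boundary_y s \<in> {2/3..3/4}"
    using side[of "1/2" "pi/2"] boundary_range(2)[of s] by (auto simp: * boundary_y_def)
  show "s \<in> {3/4..1} \<Longrightarrow> boundary_x s \<in> {1/4..1/3}"
    using side[of "3/4" "pi"] boundary_range(1)[of s] by (simp add: * boundary_x_def)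
qed

text \<open>
  Traverses the four quarters of \<open>[0, 1]\<close> during the times that \<open>word_lift\<close> gives to the first
  four letters. The slopes \<open>1/2, 1, 2, 4\<close> increase, so the function is a maximum of four
  linear ones, cut off at \<open>1\<close> during the final rest.
\<close>

definition square_parameter :: "real \<Rightarrow> real" where
  "square_parameter t = min 1 (max (max (t / 2) (t - 1/4)) (max (2 * t - 1) (4 * t - 11/4)))"

text \<open>
  The counterclockwise circle moves along the bottom, right, top and left side of the unit
  square, as does the lift of the commutator.
\<close>

lemma represents_boundary: "represents [X1, X2, X1inv, X2inv] boundary_loop"
proof (rule represents_reparametrize[where f = square_parameter])
  have cont: "continuous_on S boundary_x" "continuous_on S boundary_y" for S
    using smooth_lift.derivs[OF smooth_lift_boundary]
    by (auto intro!: continuous_at_imp_continuous_on DERIV_isCont)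
  show param: "continuous_on {0..1} square_parameter" "square_parameter \<in> {0..1} \<rightarrow> {0..1}"
    "square_parameter 0 = 0" "square_parameter 1 = 1"
    unfolding square_parameter_def by (auto intro!: continuous_intros)
  show "path boundary_loop"
    unfolding path_def boundary_loop_def by (intro continuous_intros cont)
  show "pathfinish boundary_loop = pathstart boundary_loop"
    using boundary_periodic[of 0] by (simp add: pathfinish_def pathstart_def boundary_loop_def)
  show "path_image boundary_loop \<subseteq> one_holed_torus"
  proof -
    have "common_strip (boundary_x s, boundary_y s) (boundary_x s, boundary_y s)" if s: "s \<in> {0..1}" for s
    proof -
      from s consider "s \<in> {0..1/4}" | "s \<in> {1/4..1/2}" | "s \<in> {1/2..3/4}" | "s \<in> {3/4..1}"
        by fastforce
      then show ?thesis
      proof cases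
        case 1
        from boundary_in_strip(1)[OF this] show ?thesis by (intro common_stripI[of _ _ 0]) auto
      next
        case 2
        from boundary_in_strip(2)[OF this] show ?thesis by (intro common_stripI[of _ _ _ 1]) auto
      next
        case 3
        from boundary_in_strip(3)[OF this] show ?thesis by (intro common_stripI[of _ _ 1]) auto
      next
        case 4
        from boundary_in_strip(4)[OF this] show ?thesis by (intro common_stripI[of _ _ _ 0]) auto
      qed
    qed
    then show ?thesis
      by (auto simp: path_image_def boundary_loop_def intro!: torus_pt_in_one_holed_torus)
  qed
  show "represents [X1, X2, X1inv, X2inv] (boundary_loop \<circ> square_parameter)"
  proof (rule represents_lift)
    show "path (\<lambda>t. (boundary_x (square_parameter t), boundary_y (square_parameter t)))"
      unfolding path_def
      by (intro continuous_intros continuous_on_compose2[OF cont(1) param(1)] continuous_on_compose2[OF cont(2) param(1)]) auto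
    fix t :: real assume "t \<in> {0..1}"
    then consider "t \<in> {0..1/2}" | "t \<in> {1/2<..3/4}" | "t \<in> {3/4<..7/8}" | "t \<in> {7/8<..1}"
      by fastforce
    then show "common_strip (word_lift [X1, X2, X1inv, X2inv] t)
        (boundary_x (square_parameter t), boundary_y (square_parameter t))"
    proof cases
      case 1
      then have "square_parameter t \<in> {0..1/4}" by (auto simp: square_parameter_def)
      from boundary_in_strip(1)[OF this] 1 show ?thesis by (intro common_stripI[of _ _ 0]) auto
    next
      case 2
      then have "square_parameter t \<in> {1/4..1/2}" by (auto simp: square_parameter_def)
      from boundary_in_strip(2)[OF this] 2 show ?thesis by (intro common_stripI[of _ _ _ 1]) auto
    next
      case 3
      then have "square_parameter t \<in> {1/2..3/4}" by (auto simp: square_parameter_def)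
      from boundary_in_strip(3)[OF this] 3 show ?thesis by (intro common_stripI[of _ _ 1]) auto
    next
      case 4
      then have "square_parameter t \<in> {3/4..1}" by (auto simp: square_parameter_def)
      from boundary_in_strip(4)[OF this] 4 show ?thesis by (intro common_stripI[of _ _ _ 0]) auto
    qed
  next
    show "(boundary_x (square_parameter 1), boundary_y (square_parameter 1)) -
        (boundary_x (square_parameter 0), boundary_y (square_parameter 0)) = word_lift [X1, X2, X1inv, X2inv] 1"
      using boundary_periodic[of 0] by (simp add: param zero_prod_def)
  qed (auto simp: boundary_loop_def)
qed

lemma immersed_boundary: "immersed_closed_curve boundary_loop"
  unfolding curve_boundary[symmetric]
proof (rule smooth_lift.immersed_curve[OF smooth_lift_boundary])
  show "represents [X1, X2, X1inv, X2inv] (smooth_lift.curve boundary_x boundary_y)"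
    by (simp only: curve_boundary represents_boundary)
  show "boundary_x (s + 1) - boundary_x s \<in> \<int>" "boundary_y (s + 1) - boundary_y s \<in> \<int>" for s
    by (simp_all add: boundary_periodic)
  show "- (pi / 2) * sin (boundary_angle s) \<noteq> 0 \<or> (pi / 2) * cos (boundary_angle s) \<noteq> 0" for s
    using sin_zero_norm_cos_one[of "boundary_angle s"] by auto
qed (auto simp: boundary_angle_def intro!: continuous_intros)

lemma inj_boundary: "inj_on boundary_loop {0..<1}"
proof (rule inj_onI)
  fix s u assume su: "s \<in> {0..<1}" "u \<in> {0..<1}" and eq: "boundary_loop s = boundary_loop u"
  have "boundary_x v \<in> {0..<1}" "boundary_y v \<in> {0..<1}" for v
    using boundary_range[of v] by auto
  with eq have "boundary_x s = boundary_x u" "boundary_y s = boundary_y u"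
    by (auto simp: boundary_loop_def torus_pt_eq_iff intro!: Ints_unit_interval)
  then obtain n :: int where "boundary_angle s = boundary_angle u + 2 * pi * n"
    using sin_cos_eq_iff[of "boundary_angle s" "boundary_angle u"]
    by (auto simp: boundary_x_def boundary_y_def)
  then have "2 * pi * (s - u) = 2 * pi * n" by (simp add: boundary_angle_def algebra_simps)
  then have "s - u \<in> \<int>" by simp
  then show "s = u" using su by (intro Ints_unit_interval)
qed

lemma crossings_boundary_1: "crossings boundary_loop (line 1 0 0 0) = {}"
proof -
  have "boundary_y s \<notin> \<int>" for s
  proof
    assume "boundary_y s \<in> \<int>"
    then show False using Ints_unit_interval[of "boundary_y s" 0] boundary_range(2)[of s] by auto
  qed
  then show ?thesis by (auto simp: crossings_def boundary_loop_def line_def torus_pt_eq_iff)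
qed

text \<open>
  On the circle \<open>x - y = (cos a - sin a)/4\<close> is less than \<open>1/2\<close> in absolute value, while it
  lies in \<open>1/2 + \<int>\<close> on the line.
\<close>

lemma crossings_boundary_3: "crossings boundary_loop (line 1 1 (1/6) (-1/3)) = {}"
proof -
  have False if "boundary_x s - (u + 1/6) \<in> \<int>" "boundary_y s - (u - 1/3) \<in> \<int>" for s u
  proof -
    let ?a = "boundary_angle s"
    have "\<bar>cos ?a - sin ?a\<bar> < 2"
    proof -
      have "(cos ?a - sin ?a)\<^sup>2 + (cos ?a + sin ?a)\<^sup>2 = 2 * ((sin ?a)\<^sup>2 + (cos ?a)\<^sup>2)"
        by (simp only: power2_sum power2_diff) (simp add: algebra_simps)
      then have "(cos ?a - sin ?a)\<^sup>2 \<le> 2"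
        unfolding sin_cos_squared_add using le_add_same_cancel1[of "(cos ?a - sin ?a)\<^sup>2" "(cos ?a + sin ?a)\<^sup>2"]
        by simp
      also have "2 < (2::real)\<^sup>2" by simp
      finally show ?thesis using power2_less_imp_less[of "\<bar>cos ?a - sin ?a\<bar>" 2] by simp
    qed
    then have *: "boundary_x s - boundary_y s + 1/2 \<in> {0<..<1}"
      by (auto simp: boundary_x_def boundary_y_def abs_less_iff)
    have "boundary_x s - boundary_y s + 1/2 =
        (boundary_x s - (u + 1/6)) - (boundary_y s - (u - 1/3)) + 1" by simp
    then have "boundary_x s - boundary_y s + 1/2 \<in> \<int>"
      using that by (simp only: Ints_diff Ints_add Ints_1)
    then have "boundary_x s - boundary_y s + 1/2 = 0"
      using * by (intro Ints_unit_interval) auto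
    with * show False by simp
  qed
  then show ?thesis by (auto simp: crossings_def boundary_loop_def line_def torus_pt_eq_iff)
qed

section \<open>Reflections of the torus\<close>

text \<open>
  An orientation-reversing symmetry of the one-holed torus which permutes the standard loops
  as \<open>\<sigma>\<close> permutes the letters. It reverses the intersection signs and keeps everything else
  that the Goldman formula refers to.
\<close>

locale torus_reflection =
  fixes R :: "complex \<times> complex \<Rightarrow> complex \<times> complex" and \<sigma> :: "letter \<Rightarrow> letter"
  assumes linear: "bounded_linear R"
    and involution: "R (R p) = p"
    and torus: "p \<in> one_holed_torus \<Longrightarrow> R p \<in> one_holed_torus"
    and letters: "R \<circ> letter_loop l = letter_loop (\<sigma> l)"
    and tangent: "\<alpha> differentiable at s \<Longrightarrow> \<beta> differentiable at u \<Longrightarrow>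
      tangent_det (R \<circ> \<alpha>) s (R \<circ> \<beta>) u = - tangent_det \<alpha> s \<beta> u"
    and act: "\<sigma> = t_letter \<or> \<sigma> = i1_letter"
begin

lemma word_loop_reflect: "word_loop (map \<sigma> w) = R \<circ> word_loop w"
proof (induction w)
  case Nil
  have "R (1, 1) = (1, 1)"
    using fun_cong[OF letters[of X1], of 0] act by (auto simp: loop1_def loop2_def reversepath_def)
  moreover have "linepath (1, 1) (1, 1) t = (1, 1 :: complex)" for t
    by (simp add: linepath_def flip: scaleR_add_left)
  ultimately show ?case by (simp add: fun_eq_iff)
next
  case (Cons l w)
  then show ?case by (simp only: list.map word_loop.simps path_compose_join letters)
qed

lemma represents_reflect:
  assumes "represents w \<gamma>"
  shows "represents (map \<sigma> w) (R \<circ> \<gamma>)"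
proof -
  have "continuous_on one_holed_torus R"
    using linear by (rule linear_continuous_on)
  then show ?thesis
    using assms torus unfolding represents_def word_loop_reflect
    by (intro homotopic_loops_continuous_image) auto
qed

lemma reflect_eq_iff: "R p = R q \<longleftrightarrow> p = q"
proof
  assume "R p = R q"
  then have "R (R p) = R (R q)" by (rule arg_cong)
  then show "p = q" by (simp only: involution)
qed (rule arg_cong)

lemma immersed_reflect:
  assumes "immersed_closed_curve \<gamma>"
  shows "immersed_closed_curve (R \<circ> \<gamma>)"
proof -
  obtain D where D: "\<And>s. (\<gamma> has_vector_derivative D s) (at s)" "continuous_on UNIV D"
    using assms unfolding immersed_closed_curve_def C1_differentiable_on_def by blast
  have RD: "((R \<circ> \<gamma>) has_vector_derivative R (D s)) (at s)" for s
    using bounded_linear.has_vector_derivative[OF linear D(1)] by (simp add: o_def)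
  have "continuous_on UNIV (\<lambda>s. R (D s))"
    by (intro bounded_linear.continuous_on[OF linear] D(2))
  then have "(R \<circ> \<gamma>) C1_differentiable_on UNIV"
    unfolding C1_differentiable_on_def using RD by (intro exI[of _ "\<lambda>s. R (D s)"]) simp
  moreover have "vector_derivative (R \<circ> \<gamma>) (at s) \<noteq> 0" for s
  proof -
    have "D s \<noteq> 0"
      using assms vector_derivative_at[OF D(1)] by (simp add: immersed_closed_curve_def)
    then have "R (D s) \<noteq> R 0"
      by (simp only: reflect_eq_iff not_False_eq_True)
    then show ?thesis
      by (simp add: vector_derivative_at[OF RD] linear_simps(3)[OF linear])
  qed
  ultimately show ?thesis
    using assms torus unfolding immersed_closed_curve_def by (auto simp: image_subset_iff)
qed

lemma crossings_reflect: "crossings (R \<circ> \<alpha>) (R \<circ> \<beta>) = crossings \<alpha> \<beta>"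
  unfolding crossings_def o_def reflect_eq_iff ..

lemma tangent_reflect:
  assumes "immersed_closed_curve \<alpha>" "immersed_closed_curve \<beta>"
  shows "tangent_det (R \<circ> \<alpha>) s (R \<circ> \<beta>) u = - tangent_det \<alpha> s \<beta> u"
  using assms by (intro tangent) (simp_all add: immersed_closed_curve_def C1_differentiable_on_eq)

lemma generic_position_reflect:
  assumes "immersed_closed_curve \<alpha>" "immersed_closed_curve \<beta>" "generic_position \<alpha> \<beta>"
  shows "generic_position (R \<circ> \<alpha>) (R \<circ> \<beta>)"
proof -
  have "{s \<in> {0..<1}. (R \<circ> \<gamma>) s = p} = {s \<in> {0..<1}. \<gamma> s = R p}" for \<gamma> :: "real \<Rightarrow> complex \<times> complex" and p
    using reflect_eq_iff[of "\<gamma> _" "R p"] by (simp only: o_def involution)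
  moreover have "card {s \<in> {0..<1}. \<alpha> s = R p} + card {u \<in> {0..<1}. \<beta> u = R p} \<le> 2" for p
    using assms(3) unfolding generic_position_def by blast
  ultimately have "\<forall>p. card {s \<in> {0..<1}. (R \<circ> \<alpha>) s = p} + card {u \<in> {0..<1}. (R \<circ> \<beta>) u = p} \<le> 2"
    by simp
  with assms(3) show ?thesis
    unfolding generic_position_def crossings_reflect
      tangent_reflect[OF assms(1,1)] tangent_reflect[OF assms(1,2)] tangent_reflect[OF assms(2,2)]
      neg_equal_0_iff_equal
    by (elim conjE) (intro conjI)
qed

text \<open>
  The minus sign compensates the reversed intersection signs in the Goldman formula; the other
  axioms are unaffected by it.
\<close>

lemma goldman_bracket_reflect:
  assumes "goldman_bracket br"
  shows "goldman_bracket (\<lambda>f g. - ring_act \<sigma> (br (ring_act \<sigma> f) (ring_act \<sigma> g)))"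
proof -
  interpret goldman_bracket br by fact
  note ring = ring_act_hom ring_act_ring_act[OF act] ring_act_char_ring[OF act]
  show ?thesis
  proof
    fix f g assume "f \<in> char_ring" "g \<in> char_ring"
    then show "- ring_act \<sigma> (br (ring_act \<sigma> f) (ring_act \<sigma> g)) \<in> char_ring"
      by (intro char_ring_uminus ring closed)
    from \<open>f \<in> char_ring\<close> \<open>g \<in> char_ring\<close>
    show "- ring_act \<sigma> (br (ring_act \<sigma> g) (ring_act \<sigma> f)) = - (- ring_act \<sigma> (br (ring_act \<sigma> f) (ring_act \<sigma> g)))"
      using anticommute[of "ring_act \<sigma> f" "ring_act \<sigma> g"] by (simp add: ring)
    show "- ring_act \<sigma> (br (ring_act \<sigma> (scal c f)) (ring_act \<sigma> g)) = scal c (- ring_act \<sigma> (br (ring_act \<sigma> f) (ring_act \<sigma> g)))" for c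
      using \<open>f \<in> char_ring\<close> \<open>g \<in> char_ring\<close> scal_left[of "ring_act \<sigma> f" "ring_act \<sigma> g" c]
      by (simp add: ring) (simp add: scal_def fun_eq_iff)
    fix h assume "h \<in> char_ring"
    show "- ring_act \<sigma> (br (ring_act \<sigma> (f + g)) (ring_act \<sigma> h)) =
        - ring_act \<sigma> (br (ring_act \<sigma> f) (ring_act \<sigma> h)) + - ring_act \<sigma> (br (ring_act \<sigma> g) (ring_act \<sigma> h))"
      using \<open>f \<in> char_ring\<close> \<open>g \<in> char_ring\<close> \<open>h \<in> char_ring\<close> add_left[of "ring_act \<sigma> f" "ring_act \<sigma> g" "ring_act \<sigma> h"]
      by (simp add: ring)
    show "- ring_act \<sigma> (br (ring_act \<sigma> (f * g)) (ring_act \<sigma> h)) =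
        f * (- ring_act \<sigma> (br (ring_act \<sigma> g) (ring_act \<sigma> h))) + g * (- ring_act \<sigma> (br (ring_act \<sigma> f) (ring_act \<sigma> h)))"
      using \<open>f \<in> char_ring\<close> \<open>g \<in> char_ring\<close> \<open>h \<in> char_ring\<close> leibniz[of "ring_act \<sigma> f" "ring_act \<sigma> g" "ring_act \<sigma> h"]
      by (simp add: ring)
  next
    fix \<alpha> \<beta> a b w
    assume im: "immersed_closed_curve \<alpha>" "immersed_closed_curve \<beta>" and gen: "generic_position \<alpha> \<beta>"
      and rep: "represents a \<alpha>" "represents b \<beta>"
      and prod: "\<And>s u. (s, u) \<in> crossings \<alpha> \<beta> \<Longrightarrow> represents (w s u) (based_at \<alpha> s +++ based_at \<beta> u)"
    have "br (tr_word (map \<sigma> a)) (tr_word (map \<sigma> b)) =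
        (\<Sum>(s, u) \<in> crossings (R \<circ> \<alpha>) (R \<circ> \<beta>). scal (of_real (intersection_sign (R \<circ> \<alpha>) s (R \<circ> \<beta>) u))
           (tr_word (map \<sigma> (w s u)) - scal (1/3) (tr_word (map \<sigma> a) * tr_word (map \<sigma> b))))"
    proof (rule goldman)
      fix s u assume "(s, u) \<in> crossings (R \<circ> \<alpha>) (R \<circ> \<beta>)"
      then have "represents (map \<sigma> (w s u)) (R \<circ> (based_at \<alpha> s +++ based_at \<beta> u))"
        by (intro represents_reflect prod) (simp add: crossings_reflect)
      moreover have "R \<circ> based_at \<gamma> s = based_at (R \<circ> \<gamma>) s" for \<gamma> s
        by (simp add: based_at_def fun_eq_iff)
      ultimately show "represents (map \<sigma> (w s u)) (based_at (R \<circ> \<alpha>) s +++ based_at (R \<circ> \<beta>) u)"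
        by (simp add: path_compose_join)
    qed (intro immersed_reflect represents_reflect generic_position_reflect im rep gen)+
    moreover have "intersection_sign (R \<circ> \<alpha>) s (R \<circ> \<beta>) u = - intersection_sign \<alpha> s \<beta> u" for s u
      by (simp add: intersection_sign_def tangent_reflect im sgn_minus)
    moreover have "ring_act \<sigma> (tr_word (map \<sigma> v)) = tr_word v" for v
      by (simp add: ring_act_tr_word[OF act, symmetric] ring)
    ultimately have "ring_act \<sigma> (br (tr_word (map \<sigma> a)) (tr_word (map \<sigma> b))) =
        (\<Sum>(s, u) \<in> crossings \<alpha> \<beta>. scal (of_real (- intersection_sign \<alpha> s \<beta> u))
           (tr_word (w s u) - scal (1/3) (tr_word a * tr_word b)))"
      by (simp add: ring_act_sum case_prod_beta ring_act_hom crossings_reflect)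
    moreover have "scal (of_real (- c)) f = - scal (of_real c) f" for c f
      by (simp add: scal_def fun_eq_iff)
    ultimately show "- ring_act \<sigma> (br (ring_act \<sigma> (tr_word a)) (ring_act \<sigma> (tr_word b))) =
        (\<Sum>(s, u) \<in> crossings \<alpha> \<beta>. scal (of_real (intersection_sign \<alpha> s \<beta> u))
           (tr_word (w s u) - scal (1/3) (tr_word a * tr_word b)))"
      by (simp add: ring_act_tr_word[OF act] split_def sum_negf)
  qed
qed

end

lemma vector_derivative_linear_image:
  assumes "bounded_linear R" "\<gamma> differentiable at s"
  shows "vector_derivative (R \<circ> \<gamma>) (at s) = R (vector_derivative \<gamma> (at s))"
  using bounded_linear.has_vector_derivative[OF assms(1)] assms(2)
  unfolding vector_derivative_works o_def by (intro vector_derivative_at)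

lemma torus_reflection_swap: "torus_reflection prod.swap t_letter"
proof (rule torus_reflection.intro)
  show lin: "bounded_linear (prod.swap :: complex \<times> complex \<Rightarrow> _)"
    unfolding prod.swap_def by (intro bounded_linear_Pair bounded_linear_fst bounded_linear_snd)
  show "prod.swap p \<in> one_holed_torus" if "p \<in> one_holed_torus" for p
    using that by (auto simp: one_holed_torus_def dist_prod_def add.commute)
  show "prod.swap \<circ> letter_loop l = letter_loop (t_letter l)" for l
    by (cases l) (auto simp: loop1_def loop2_def reversepath_def)
  show "tangent_det (prod.swap \<circ> \<alpha>) s (prod.swap \<circ> \<beta>) u = - tangent_det \<alpha> s \<beta> u"
    if "\<alpha> differentiable at s" "\<beta> differentiable at u" for \<alpha> \<beta> s u
    using that
    by (simp add: tangent_det_def angular_velocity1_def angular_velocity2_def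
        vector_derivative_linear_image[OF lin])
qed simp_all

lemma torus_reflection_cnj: "torus_reflection (map_prod cnj id) i1_letter"
proof (rule torus_reflection.intro)
  show lin: "bounded_linear (map_prod cnj id :: complex \<times> complex \<Rightarrow> _)"
    unfolding map_prod_def case_prod_beta id_def
    by (intro bounded_linear_Pair bounded_linear_compose[OF bounded_linear_cnj] bounded_linear_fst bounded_linear_snd)
  have "dist (-1) (cnj z) = dist (-1) z" for z
    by (metis complex_cnj_minus complex_cnj_one complex_mod_cnj dist_norm complex_cnj_diff)
  then show "map_prod cnj id p \<in> one_holed_torus" if "p \<in> one_holed_torus" for p
    using that by (auto simp: one_holed_torus_def dist_prod_def)
  have "cis (2 * pi * (1 - t)) = cnj (cis (2 * pi * t))" for t
  proof -
    have "cis (2 * pi * (1 - t)) = cis (2 * pi * (- t))"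
      unfolding cis_2pi_eq_iff by simp
    then show ?thesis by (simp add: cis_cnj)
  qed
  then show "map_prod cnj id \<circ> letter_loop l = letter_loop (i1_letter l)" for l
    by (cases l) (auto simp: loop1_def loop2_def reversepath_def fun_eq_iff)
  show "tangent_det (map_prod cnj id \<circ> \<alpha>) s (map_prod cnj id \<circ> \<beta>) u = - tangent_det \<alpha> s \<beta> u"
    if "\<alpha> differentiable at s" "\<beta> differentiable at u" for \<alpha> \<beta> s u
    using that
    by (simp add: tangent_det_def angular_velocity1_def angular_velocity2_def algebra_simps
        vector_derivative_linear_image[OF lin])
  show "map_prod cnj id (map_prod cnj id p) = p" for p :: "complex \<times> complex"
    by (simp add: prod_eq_iff)
qed simp_all

section \<open>Trace identities\<close>

fun inv_letter :: "letter \<Rightarrow> letter" where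
  "inv_letter X1 = X1inv"
| "inv_letter X1inv = X1"
| "inv_letter X2 = X2inv"
| "inv_letter X2inv = X2"

definition inv_word :: "word \<Rightarrow> word" where
  "inv_word w = rev (map inv_letter w)"

lemma word_mat_append: "word_mat \<rho> (u @ v) = word_mat \<rho> u ** word_mat \<rho> v"
  by (induction u) (simp_all add: matrix_mul_assoc)

lemma letter_cancel: "Rep_sl3 (letter_val \<rho> l) ** Rep_sl3 (letter_val \<rho> (inv_letter l)) = mat 1"
  by (cases l) (simp_all add: Rep_sl3_inv matrix_inv_Rep_sl3)

lemma word_mat_inv: "word_mat \<rho> w ** word_mat \<rho> (inv_word w) = mat 1"
proof (induction w)
  case Nil
  show ?case by (simp add: inv_word_def)
next
  case (Cons l w)
  have "word_mat \<rho> (l # w) ** word_mat \<rho> (inv_word (l # w)) =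
      Rep_sl3 (letter_val \<rho> l) ** (word_mat \<rho> w ** word_mat \<rho> (inv_word w)) ** Rep_sl3 (letter_val \<rho> (inv_letter l))"
    by (simp add: inv_word_def word_mat_append matrix_mul_assoc)
  then show ?case by (simp add: Cons letter_cancel)
qed

lemma det_word_mat: "det (word_mat \<rho> w) = 1"
  by (induction w) (simp_all add: det_mul det_Rep_sl3)

lemma trace_rotate: "tr_word (u @ v) = tr_word (v @ u)"
  unfolding tr_word_def word_mat_append by (intro ext trace_mul_sym)

text \<open>
  The Cayley-Hamilton identity for the matrix of the word \<open>u\<close>, as a rewriting rule for traces
  of words.
\<close>

lemma tr_word_square:
  "tr_word (u @ u @ v) = tr_word u * tr_word (u @ v) - tr_word (inv_word u) * tr_word v
     + tr_word (inv_word u @ v)"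
proof
  fix \<rho>
  obtain A where A: "Rep_sl3 A = word_mat \<rho> u"
    by (metis Abs_sl3_inverse det_word_mat mem_Collect_eq)
  have "matrix_inv (Rep_sl3 A) = matrix_inv (Rep_sl3 A) ** (Rep_sl3 A ** word_mat \<rho> (inv_word u))"
    by (simp add: A word_mat_inv)
  also have "\<dots> = word_mat \<rho> (inv_word u)"
    by (simp only: matrix_mul_assoc matrix_inv_Rep_sl3 matrix_mul_lid)
  finally have "Rep_sl3 (sl3_inv A) = word_mat \<rho> (inv_word u)"
    by (simp add: Rep_sl3_inv)
  then show "tr_word (u @ u @ v) \<rho> = (tr_word u * tr_word (u @ v) - tr_word (inv_word u) * tr_word v
     + tr_word (inv_word u @ v)) \<rho>"
    using trace_square_mult[of A "word_mat \<rho> v"] by (simp add: A tr_word_def word_mat_append matrix_mul_assoc)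
qed

lemma tr_word_cancel: "tr_word (u @ l # inv_letter l # v) = tr_word (u @ v)"
proof -
  have "word_mat \<rho> (l # inv_letter l # v) = word_mat \<rho> v" for \<rho>
    by (simp add: matrix_mul_assoc letter_cancel)
  then show ?thesis by (simp add: tr_word_def word_mat_append)
qed

lemma tr_word_Nil: "tr_word [] = 3"
  by (simp add: tr_word_def trace_def mat_def sum_3 fun_eq_iff)

lemma trace_X1X1X2: "tr_word [X1, X1, X2] = tg Z1 * tg Z3 - tg Zm1 * tg Z2 + tg Zm4"
  using tr_word_square[of "[X1]" "[X2]"] by (simp add: tg_def inv_word_def)

lemma trace_X1X1: "tr_word [X1, X1] = tg Z1 ^ 2 - 2 * tg Zm1"
  using tr_word_square[of "[X1]" "[]"] by (simp add: tg_def inv_word_def tr_word_Nil power2_eq_square algebra_simps)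

lemma trace_X1X2invX1inv: "tr_word [X1, X2inv, X1inv] = tg Zm2"
  using trace_rotate[of "[X1, X2inv]" "[X1inv]"] tr_word_cancel[of "[]" X1inv "[X2inv]"]
  by (simp add: tg_def)

text \<open>
  Up to cyclic rotation the word is \<open>(x\<^sub>1x\<^sub>2)\<^sup>2x\<^sub>2\<^sup>-\<^sup>2\<close>. Removing the square of \<open>x\<^sub>1x\<^sub>2\<close>
  leaves powers of \<open>x\<^sub>2\<^sup>-\<^sup>1\<close>, which are removed in the same way.
\<close>

lemma trace_X2X1X2invX1:
  "tr_word [X2, X1, X2inv, X1] =
     tg Z3 * tg Z4 + tg Z2 * tg Zm3 - tg Zm1 * tg Z2 * tg Zm2 + tg Zm4 * tg Zm2 + tg Zm1"
proof -
  have sq: "tr_word [X2inv, X2inv] = tg Zm2 ^ 2 - 2 * tg Z2"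
    using tr_word_square[of "[X2inv]" "[]"]
    by (simp add: tg_def inv_word_def tr_word_Nil power2_eq_square algebra_simps)
  have m3: "tr_word [X2inv, X1inv] = tg Zm3"
    using trace_rotate[of "[X2inv]" "[X1inv]"] by (simp add: tg_def)
  have m4: "tr_word [X2, X1inv] = tg Zm4"
    using trace_rotate[of "[X2]" "[X1inv]"] by (simp add: tg_def)
  have "tr_word [X2inv, X1inv, X2inv, X2inv] = tr_word [X2inv, X2inv, X2inv, X1inv]"
    using trace_rotate[of "[X2inv, X1inv]" "[X2inv, X2inv]"] by simp
  also have "\<dots> = tg Zm2 * (tg Zm2 * tg Zm3 - tg Z2 * tg Zm1 + tg Zm4) - tg Z2 * tg Zm3 + tg Zm1"
    using tr_word_square[of "[X2inv]" "[X2inv, X1inv]"] tr_word_square[of "[X2inv]" "[X1inv]"]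
      tr_word_cancel[of "[]" X2 "[X1inv]"] m3 m4
    by (simp add: tg_def inv_word_def)
  finally have cube: "tr_word [X2inv, X1inv, X2inv, X2inv] =
      tg Zm2 * (tg Zm2 * tg Zm3 - tg Z2 * tg Zm1 + tg Zm4) - tg Z2 * tg Zm3 + tg Zm1" .
  have "tr_word [X2, X1, X2inv, X1] = tr_word [X1, X2, X1, X2inv]"
    using trace_rotate[of "[X2, X1, X2inv]" "[X1]"] by simp
  also have "\<dots> = tr_word [X1, X2, X1, X2, X2inv, X2inv]"
    using tr_word_cancel[of "[X1, X2, X1]" X2 "[X2inv]"] by simp
  also have "\<dots> = tg Z3 * tr_word [X1, X2, X2inv, X2inv] - tg Zm3 * tr_word [X2inv, X2inv]
      + tr_word [X2inv, X1inv, X2inv, X2inv]"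
    using tr_word_square[of "[X1, X2]" "[X2inv, X2inv]"] m3 by (simp add: tg_def inv_word_def)
  also have "tr_word [X1, X2, X2inv, X2inv] = tg Z4"
    using tr_word_cancel[of "[X1]" X2 "[X2inv]"] by (simp add: tg_def)
  finally show ?thesis
    unfolding sq cube by (simp add: fun_eq_iff power2_eq_square algebra_simps)
qed

section \<open>Brackets of generators\<close>

text \<open>
  Quantifying over all Goldman brackets is what makes symmetry usable: a reflected bracket has
  the same values, without being known to equal the given bracket.
\<close>

definition bracket_value :: "(rep \<Rightarrow> complex) \<Rightarrow> (rep \<Rightarrow> complex) \<Rightarrow> (rep \<Rightarrow> complex) \<Rightarrow> bool" where
  "bracket_value f g h \<longleftrightarrow> (\<forall>br. goldman_bracket br \<longrightarrow> br f g = h)"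

lemma bracket_valueD: "bracket_value f g h \<Longrightarrow> goldman_bracket br \<Longrightarrow> br f g = h"
  by (simp only: bracket_value_def)

lemma bracket_value_reflect:
  assumes "\<sigma> = t_letter \<or> \<sigma> = i1_letter" and "bracket_value f g h"
  shows "bracket_value (ring_act \<sigma> f) (ring_act \<sigma> g) (- ring_act \<sigma> h)"
  unfolding bracket_value_def
proof (intro allI impI)
  fix br assume br: "goldman_bracket br"
  then have "goldman_bracket (\<lambda>f g. - ring_act \<sigma> (br (ring_act \<sigma> f) (ring_act \<sigma> g)))"
    using assms(1) torus_reflection.goldman_bracket_reflect[OF torus_reflection_swap]
      torus_reflection.goldman_bracket_reflect[OF torus_reflection_cnj] by blast
  then have "- ring_act \<sigma> (br (ring_act \<sigma> f) (ring_act \<sigma> g)) = h"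
    using assms(2) unfolding bracket_value_def by blast
  then have "ring_act \<sigma> h = ring_act \<sigma> (- ring_act \<sigma> (br (ring_act \<sigma> f) (ring_act \<sigma> g)))"
    by simp
  then show "br (ring_act \<sigma> f) (ring_act \<sigma> g) = - ring_act \<sigma> h"
    by (simp add: ring_act_uminus ring_act_ring_act[OF assms(1)])
qed

lemma bracket_value_swap:
  assumes "bracket_value f g h" "f \<in> char_ring" "g \<in> char_ring"
  shows "bracket_value g f (- h)"
  using assms goldman_bracket.anticommute unfolding bracket_value_def by metis

text \<open>Anticommutativity, in characteristic zero.\<close>

lemma bracket_value_self:
  assumes "f \<in> char_ring"
  shows "bracket_value f f 0"
  unfolding bracket_value_def
proof (intro allI impI)
  fix br assume "goldman_bracket br"
  then have "br f f = - br f f"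
    using assms goldman_bracket.anticommute by blast
  then have "br f f \<rho> = - br f f \<rho>" for \<rho>
    by (metis uminus_apply)
  then show "br f f = 0"
    by (simp add: fun_eq_iff)
qed

lemma bracket_value_disjoint:
  assumes "immersed_closed_curve \<alpha>" "immersed_closed_curve \<beta>" "generic_position \<alpha> \<beta>"
    and "represents a \<alpha>" "represents b \<beta>" "crossings \<alpha> \<beta> = {}"
  shows "bracket_value (tr_word a) (tr_word b) 0"
  unfolding bracket_value_def
proof (intro allI impI)
  fix br assume "goldman_bracket br"
  \<comment> \<open>without crossings the words at the crossings are immaterial\<close>
  from goldman_bracket.goldman[OF this assms(1-5), of "\<lambda>_ _. []"]
  show "br (tr_word a) (tr_word b) = 0"
    by (simp add: assms(6))
qed

lemma intersection_sign_line:
  "intersection_sign (line p q a b) s (line p' q' a' b') u = sgn (of_int (p * q' - q * p'))"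
  unfolding intersection_sign_def tangent_det_line sgn_mult by simp

text \<open>
  All crossings of two straight lines have the same sign, that of the determinant of their
  directions.
\<close>

lemma bracket_value_lines:
  assumes C: "crossings (line p q x y) (line p' q' x' y') = C"
    and "\<bar>p\<bar> = 1 \<or> \<bar>q\<bar> = 1" "\<bar>p'\<bar> = 1 \<or> \<bar>q'\<bar> = 1" "p * q' - q * p' \<noteq> 0"
    and "represents a (line p q x y)" "represents b (line p' q' x' y')"
    and "\<forall>(s, u) \<in> C.
      represents (w s u) (based_at (line p q x y) s +++ based_at (line p' q' x' y') u)"
  shows "bracket_value (tr_word a) (tr_word b)
    (\<Sum>(s, u) \<in> C.
       scal (of_real (sgn (of_int (p * q' - q * p')))) (tr_word (w s u) - scal (1/3) (tr_word a * tr_word b)))"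
  unfolding bracket_value_def
proof (intro allI impI)
  fix br assume br: "goldman_bracket br"
  have "p \<noteq> 0 \<or> q \<noteq> 0" "p' \<noteq> 0 \<or> q' \<noteq> 0" using assms(2,3) by auto
  then have "br (tr_word a) (tr_word b) =
      (\<Sum>(s, u) \<in> C.
        scal (of_real (intersection_sign (line p q x y) s (line p' q' x' y') u))
          (tr_word (w s u) - scal (1/3) (tr_word a * tr_word b)))"
    using assms unfolding C[symmetric]
    by (intro goldman_bracket.goldman[OF br] immersed_line generic_position_lines) auto
  then show "br (tr_word a) (tr_word b) = (\<Sum>(s, u) \<in> C.
       scal (of_real (sgn (of_int (p * q' - q * p')))) (tr_word (w s u) - scal (1/3) (tr_word a * tr_word b)))"
    by (simp only: intersection_sign_line)
qed

lemma scal_1: "scal 1 f = f" and scal_minus_1: "scal (-1) f = - f"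
  by (simp_all add: scal_def fun_eq_iff)

lemma bracket_1_2: "bracket_value (tg Z1) (tg Z2) (tg Z3 - scal (1/3) (tg Z1 * tg Z2))"
  using bracket_value_lines[OF crossings_1_2 _ _ _ represents_X1[of 0] represents_X2, where w = "\<lambda>_ _. [X1, X2]"]
    represents_product_1_2
  by (simp add: tg_def scal_1)

lemma bracket_1_3:
  "bracket_value (tg Z1) (tg Z3) (scal (2/3) (tg Z1 * tg Z3) - tg Zm1 * tg Z2 + tg Zm4)"
proof -
  have "bracket_value (tg Z1) (tg Z3) (tr_word [X1, X1, X2] - scal (1/3) (tg Z1 * tg Z3))"
    using bracket_value_lines[OF crossings_1_3 _ _ _ represents_X1[of 0] represents_X1X2, where w = "\<lambda>_ _. [X1, X1, X2]"]
      represents_product_1_3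
    by (simp add: tg_def scal_1)
  also have "tr_word [X1, X1, X2] - scal (1/3) (tg Z1 * tg Z3) =
      scal (2/3) (tg Z1 * tg Z3) - tg Zm1 * tg Z2 + tg Zm4"
    unfolding trace_X1X1X2 by (simp add: fun_eq_iff scal_def)
  finally show ?thesis .
qed

lemma bracket_1_m3: "bracket_value (tg Z1) (tg Zm3) (- tg Zm2 + scal (1/3) (tg Z1 * tg Zm3))"
  using bracket_value_lines[OF crossings_1_m3 _ _ _ represents_X1[of "-1/6"] represents_X1inv_X2inv,
      where w = "\<lambda>_ _. [X1, X2inv, X1inv]"] represents_product_1_m3
  by (simp add: tg_def scal_minus_1 trace_X1X2invX1inv[unfolded tg_def])

text \<open>
  The two lines meet twice: the crossings are at the parameters \<open>1/3\<close> and \<open>5/6\<close>, and both are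
  negative.
\<close>

lemma bracket_3_4:
  "bracket_value (tg Z3) (tg Z4) (- (tg Z1 ^ 2) + tg Zm1 - tg Zm4 * tg Zm2 - tg Z2 * tg Zm3
     + tg Zm1 * tg Z2 * tg Zm2 - scal (1/3) (tg Z3 * tg Z4))"
proof -
  have "bracket_value (tg Z3) (tg Z4)
      (- (tr_word [X2, X1, X2inv, X1] - scal (1/3) (tg Z3 * tg Z4)) - (tr_word [X1, X1] - scal (1/3) (tg Z3 * tg Z4)))"
    using bracket_value_lines[OF crossings_3_4 _ _ _ represents_X1X2 represents_X1X2inv,
        where w = "\<lambda>s _. if s = 1/3 then [X2, X1, X2inv, X1] else [X1, X1]"]
      represents_product_3_4_first represents_product_3_4_second
    by (simp add: tg_def scal_minus_1)
  also have "- (tr_word [X2, X1, X2inv, X1] - scal (1/3) (tg Z3 * tg Z4)) - (tr_word [X1, X1] - scal (1/3) (tg Z3 * tg Z4)) =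
      - (tg Z1 ^ 2) + tg Zm1 - tg Zm4 * tg Zm2 - tg Z2 * tg Zm3 + tg Zm1 * tg Z2 * tg Zm2 - scal (1/3) (tg Z3 * tg Z4)"
    unfolding trace_X2X1X2invX1 trace_X1X1 by (simp add: fun_eq_iff scal_def)
  finally show ?thesis .
qed

lemma bracket_1_m1: "bracket_value (tg Z1) (tg Zm1) 0"
proof -
  have "bracket_value (tr_word [X1]) (tr_word [X1inv]) 0"
    by (intro bracket_value_disjoint[where \<alpha> = "line 1 0 0 0" and \<beta> = "line (-1) 0 0 (1/4)"]
        immersed_line[where w = "[X1]"] immersed_line[where w = "[X1inv]"] generic_position_lines represents_X1 represents_X1inv crossings_1_m1 disjI2[OF crossings_1_m1])
      simp_all
  then show ?thesis by (simp add: tg_def)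
qed

lemma bracket_3_m3: "bracket_value (tg Z3) (tg Zm3) 0"
proof -
  have "bracket_value (tr_word [X1, X2]) (tr_word [X1inv, X2inv]) 0"
    by (intro bracket_value_disjoint[OF _ _ _ represents_X1X2 represents_X1inv_X2inv]
        immersed_line[OF represents_X1X2] immersed_line[OF represents_X1inv_X2inv] generic_position_lines crossings_3_m3 disjI2[OF crossings_3_m3])
      simp_all
  then show ?thesis by (simp add: tg_def)
qed

lemma bracket_boundary_line:
  assumes "crossings boundary_loop (line p q a b) = {}" "represents w (line p q a b)" "\<bar>p\<bar> = 1 \<or> \<bar>q\<bar> = 1"
  shows "bracket_value (tg Z5) (tr_word w) 0"
proof -
  have "p \<noteq> 0 \<or> q \<noteq> 0" using assms(3) by auto
  then have "bracket_value (tr_word [X1, X2, X1inv, X2inv]) (tr_word w) 0"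
    using assms by (intro bracket_value_disjoint[OF _ _ _ represents_boundary assms(2)] immersed_boundary immersed_line
        generic_position_simple inj_boundary inj_line) auto
  then show ?thesis by (simp add: tg_def)
qed

section \<open>Orbits under the dihedral group\<close>

lemma bracket_value_tg_reflect:
  assumes "u \<noteq> Z5" "v \<noteq> Z5" "bracket_value (tg u) (tg v) h"
  shows "bracket_value (tg (t_coord u)) (tg (t_coord v)) (- ring_act t_letter h)"
    and "bracket_value (tg (i1_coord u)) (tg (i1_coord v)) (- ring_act i1_letter h)"
  using bracket_value_reflect[OF _ assms(3)] assms(1,2) by (metis ring_act_tg)+

text \<open>
  What the symmetry argument uses of a value is that all Goldman brackets agree on it.
\<close>

definition determined :: "coord \<Rightarrow> coord \<Rightarrow> bool" where
  "determined u v \<longleftrightarrow> (\<exists>h. bracket_value (tg u) (tg v) h)"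

lemma coord_ne_Z5: "t_coord u \<noteq> Z5 \<longleftrightarrow> u \<noteq> Z5" "i1_coord u \<noteq> Z5 \<longleftrightarrow> u \<noteq> Z5"
  by (cases u; simp)+

lemma determined_reflect:
  assumes "determined u v" "u \<noteq> Z5" "v \<noteq> Z5"
  shows "determined (t_coord u) (t_coord v)" "determined (i1_coord u) (i1_coord v)"
  using assms bracket_value_tg_reflect unfolding determined_def by blast+

lemma determined_swap: "determined u v \<Longrightarrow> determined v u"
  unfolding determined_def using bracket_value_swap tg_char_ring by blast

text \<open>
  Two different ones of the eight generators are, up to order, the image of one of six pairs
  under the dihedral group, and all six are computed above.
\<close>

lemma determined_all:
  assumes "u \<noteq> Z5" "v \<noteq> Z5"
  shows "determined u v"
proof -
  have base: "determined w w" "determined Z1 Z2" "determined Z1 Z3" "determined Z1 Zm3"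
    "determined Z3 Z4" "determined Z1 Zm1" "determined Z3 Zm3" for w
    unfolding determined_def
    using bracket_value_self tg_char_ring bracket_1_2 bracket_1_3 bracket_1_m3 bracket_3_4 bracket_1_m1 bracket_3_m3
    by blast+
  note t = determined_reflect(1) and i = determined_reflect(2)
  have i2: "determined (t_coord (i1_coord (t_coord u))) (t_coord (i1_coord (t_coord v)))"
    if "determined u v" "u \<noteq> Z5" "v \<noteq> Z5" for u v
    using that by (intro t i) (simp_all add: coord_ne_Z5)
  \<comment> \<open>\<open>i2\<close> fixes \<open>Z1\<close> and inverts \<open>x\<^sub>2\<close>\<close>
  have 1: "determined Z1 v" if "v \<noteq> Z5" for v
    using base i2[OF base(2)] i2[OF base(3)] i2[OF base(4)] that by (cases v) simp_all
  have 3: "determined Z3 v" if "v \<noteq> Z5" for v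
  proof -
    have "determined Z3 Z1" by (rule determined_swap) (rule 1, simp)
    moreover from t[OF this] have "determined Z3 Z2" by simp
    moreover have "determined Z3 Zm1"
      using i[OF determined_swap[OF 1[of Zm4]]] by simp
    moreover from t[OF this] have "determined Z3 Zm2" by simp
    moreover from t[OF base(5)] have "determined Z3 Zm4" by simp
    ultimately show ?thesis using base that by (cases v) simp_all
  qed
  have 11: "determined Zm1 v" "determined Zm4 v" if "v \<noteq> Z5" for v
    using i[OF 1[of "i1_coord v"]] i[OF 3[of "i1_coord v"]] that by (cases v; simp)+
  have 22: "determined Z2 v" "determined Zm2 v" "determined Z4 v" if "v \<noteq> Z5" for v
    using t[OF 1[of "t_coord v"]] t[OF 11(1)[of "t_coord v"]] t[OF 11(2)[of "t_coord v"]] that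
    by (cases v; simp)+
  have "determined Zm3 v" if "v \<noteq> Z5" for v
    using i[OF 22(3)[of "i1_coord v"]] that by (cases v; simp)
  with 1 3 11 22 assms show ?thesis by (cases u) simp_all
qed

text \<open>
  The reflected bracket takes the same values on generators as the bracket itself.
\<close>

lemma bracket_anti_equivariant:
  assumes "goldman_bracket br" "u \<noteq> Z5" "v \<noteq> Z5"
  shows "ring_act t_letter (br (tg u) (tg v)) = - br (tg (t_coord u)) (tg (t_coord v))"
    and "ring_act i1_letter (br (tg u) (tg v)) = - br (tg (i1_coord u)) (tg (i1_coord v))"
proof -
  obtain h where h: "bracket_value (tg u) (tg v) h"
    using determined_all assms unfolding determined_def by blast
  with assms(1) have "br (tg u) (tg v) = h" by (simp add: bracket_value_def)
  moreover have "br (tg (t_coord u)) (tg (t_coord v)) = - ring_act t_letter h"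
    "br (tg (i1_coord u)) (tg (i1_coord v)) = - ring_act i1_letter h"
    using assms(1) bracket_value_tg_reflect[OF assms(2,3) h] unfolding bracket_value_def by blast+
  ultimately show "ring_act t_letter (br (tg u) (tg v)) = - br (tg (t_coord u)) (tg (t_coord v))"
    "ring_act i1_letter (br (tg u) (tg v)) = - br (tg (i1_coord u)) (tg (i1_coord v))"
    by simp_all
qed

text \<open>
  The rotation \<open>x\<^sub>1 \<mapsto> x\<^sub>2 \<mapsto> x\<^sub>1\<^sup>-\<^sup>1\<close> preserves the boundary class, and \<open>t\<^sub>(\<^sub>1\<^sub>)\<close> and \<open>t\<^sub>(\<^sub>3\<^sub>)\<close>
  represent its two orbits on the other generators. A reflection alone would reverse the
  boundary curve.
\<close>

lemma bracket_Z5: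
  assumes "goldman_bracket br"
  shows "br (tg Z5) (tg v) = 0"
proof -
  have rot: "bracket_value (tg Z5) (tg (i1_coord (t_coord v))) 0"
    if "bracket_value (tg Z5) (tg v) 0" "v \<noteq> Z5" for v
  proof -
    have "bracket_value (ring_act i1_letter (ring_act t_letter (tg Z5))) (ring_act i1_letter (ring_act t_letter (tg v))) 0"
      using bracket_value_reflect[of i1_letter, OF _ bracket_value_reflect[of t_letter, OF _ that(1)]]
      by (simp only: ring_act_uminus ring_act_0 minus_zero simp_thms)
    moreover have "ring_act i1_letter (ring_act t_letter (tg Z5)) = tg Z5"
      using trace_rotate[of "[X1, X2, X1inv]" "[X2inv]"] trace_rotate[of "[X2]" "[X1inv, X2inv, X1]"]
      by (simp add: tg_def ring_act_tr_word)
    moreover have "ring_act i1_letter (ring_act t_letter (tg v)) = tg (i1_coord (t_coord v))"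
      using that(2) by (cases v) (simp_all add: ring_act_tg)
    ultimately show ?thesis by simp
  qed
  have 1: "bracket_value (tg Z5) (tg Z1) 0"
    using bracket_boundary_line[OF crossings_boundary_1 represents_X1] by (simp add: tg_def)
  have 3: "bracket_value (tg Z5) (tg Z3) 0"
    using bracket_boundary_line[OF crossings_boundary_3 represents_X1X2] by (simp add: tg_def)
  note r1 = rot[OF 1, simplified] note r2 = rot[OF r1, simplified] note r3 = rot[OF r2, simplified]
  note s1 = rot[OF 3, simplified] note s2 = rot[OF s1, simplified] note s3 = rot[OF s2, simplified]
  have "bracket_value (tg Z5) (tg v) 0"
    using 1 3 r1 r2 r3 s1 s2 s3 bracket_value_self[OF tg_char_ring] by (cases v) simp_all
  then show ?thesis using assms by (rule bracket_valueD)
qed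

section \<open>The bracket as a biderivation\<close>

lemma poly_fun_differentiable:
  assumes "F \<in> poly_fun"
  shows "((\<lambda>x. F (z(k := x))) has_field_derivative partial k F z) (at (z k))"
proof -
  have "\<exists>D. ((\<lambda>x. F (z(k := x))) has_field_derivative D) (at (z k))"
    using assms
  proof (induction rule: poly_fun.induct)
    case (const c)
    show ?case by (rule exI, rule DERIV_const)
  next
    case (var j)
    show ?case
      by (cases "j = k") (auto intro: DERIV_ident DERIV_const)
  next
    case (add F G)
    then obtain D E where "((\<lambda>x. F (z(k := x))) has_field_derivative D) (at (z k))"
      "((\<lambda>x. G (z(k := x))) has_field_derivative E) (at (z k))" by blast
    from DERIV_add[OF this] show ?case unfolding plus_fun_def by blast
  next
    case (mult F G)
    then obtain D E where "((\<lambda>x. F (z(k := x))) has_field_derivative D) (at (z k))"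
      "((\<lambda>x. G (z(k := x))) has_field_derivative E) (at (z k))" by blast
    from DERIV_mult[OF this] show ?case unfolding times_fun_def by blast
  qed
  then show ?thesis
    unfolding partial_def by (metis DERIV_imp_deriv)
qed

lemma partial_rules:
  shows partial_const: "partial k (\<lambda>z. c) = 0"
    and partial_var: "partial k (\<lambda>z. z j) = (if j = k then 1 else 0)"
    and partial_add: "F \<in> poly_fun \<Longrightarrow> G \<in> poly_fun \<Longrightarrow> partial k (F + G) = partial k F + partial k G"
    and partial_mult: "F \<in> poly_fun \<Longrightarrow> G \<in> poly_fun \<Longrightarrow> partial k (F * G) = F * partial k G + G * partial k F"
proof -
  show "partial k (\<lambda>z. c) = 0" "partial k (\<lambda>z. z j) = (if j = k then 1 else 0)"
    by (auto simp: partial_def fun_eq_iff)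
  assume F: "F \<in> poly_fun" and G: "G \<in> poly_fun"
  note D = poly_fun_differentiable[OF F, where k = k] poly_fun_differentiable[OF G, where k = k]
  show "partial k (F + G) = partial k F + partial k G"
  proof
    show "partial k (F + G) z = (partial k F + partial k G) z" for z
      using DERIV_imp_deriv[OF DERIV_add[OF D(1)[of z] D(2)[of z]]]
      by (simp add: partial_def[of _ "F + G"])
  qed
  show "partial k (F * G) = F * partial k G + G * partial k F"
  proof
    show "partial k (F * G) z = (F * partial k G + G * partial k F) z" for z
      using DERIV_imp_deriv[OF DERIV_mult[OF D(1)[of z] D(2)[of z]]]
      by (simp add: partial_def[of _ "F * G"] mult.commute)
  qed
qed

lemma subst_gens_rules:
  shows subst_gens_add: "subst_gens (F + G) = subst_gens F + subst_gens G"
    and subst_gens_mult: "subst_gens (F * G) = subst_gens F * subst_gens G"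
    and subst_gens_0: "subst_gens 0 = 0"
    and subst_gens_1: "subst_gens 1 = 1"
    and subst_gens_const: "subst_gens (\<lambda>z. c) = scal c 1"
    and subst_gens_var: "subst_gens (\<lambda>z. z k) = tg k"
  by (simp_all add: subst_gens_def scal_def fun_eq_iff)

lemma one_char_ring: "1 \<in> char_ring"
  using char_ring_const[of 1] by (simp add: one_fun_def)

lemma subst_gens_char_ring:
  assumes "F \<in> poly_fun"
  shows "subst_gens F \<in> char_ring"
  using assms
proof (induction rule: poly_fun.induct)
  case (const c)
  show ?case using char_ring_const[of c] by (simp add: subst_gens_def)
next
  case (var k)
  show ?case by (simp only: subst_gens_var tg_char_ring)
next
  case (add F G)
  then show ?case by (simp only: subst_gens_add char_ring_add)
next
  case (mult F G)
  then show ?case by (simp only: subst_gens_mult char_ring_mult)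
qed

context goldman_bracket
begin

text \<open>A derivation kills \<open>1 = 1 \<cdot> 1\<close>.\<close>

lemma bracket_one:
  assumes "h \<in> char_ring"
  shows "br 1 h = 0"
proof -
  have "br 1 h = br 1 h + br 1 h"
    using leibniz[OF one_char_ring one_char_ring assms] by simp
  then show ?thesis by simp
qed

lemma bracket_poly_left:
  assumes "F \<in> poly_fun" and h: "h \<in> char_ring"
  shows "br (subst_gens F) h = (\<Sum>u\<in>UNIV. subst_gens (partial u F) * br (tg u) h)"
  using assms(1)
proof (induction rule: poly_fun.induct)
  case (const c)
  have "br (scal c 1) h = scal c 0"
    using scal_left[OF one_char_ring h] bracket_one[OF h] by simp
  then show ?case
    by (simp only: subst_gens_const partial_const subst_gens_0) (simp add: scal_def fun_eq_iff)
next
  case (var k)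
  have "subst_gens (if k = u then 1 else 0) * br (tg u) h = (if k = u then br (tg u) h else 0)" for u
    by (simp add: subst_gens_0 subst_gens_1)
  then show ?case by (simp only: subst_gens_var partial_var) simp
next
  case (add F G)
  then show ?case
    using add_left[OF subst_gens_char_ring subst_gens_char_ring h, OF add.hyps(1,2)]
    by (simp only: subst_gens_add partial_add distrib_right sum.distrib)
next
  case (mult F G)
  have "br (subst_gens (F * G)) h = subst_gens F * br (subst_gens G) h + subst_gens G * br (subst_gens F) h"
    using leibniz[OF subst_gens_char_ring subst_gens_char_ring h, OF mult.hyps(1,2)]
    by (simp only: subst_gens_mult)
  then show ?case
    using mult by (simp only: subst_gens_add subst_gens_mult partial_mult distrib_right sum.distrib
        sum_distrib_left mult.assoc)
qed

lemma bracket_poly_right: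
  assumes "G \<in> poly_fun" and h: "h \<in> char_ring"
  shows "br h (subst_gens G) = (\<Sum>v\<in>UNIV. subst_gens (partial v G) * br h (tg v))"
proof -
  have "br h (subst_gens G) = - br (subst_gens G) h"
    by (rule anticommute) (intro subst_gens_char_ring assms)+
  also have "\<dots> = (\<Sum>v\<in>UNIV. subst_gens (partial v G) * - br (tg v) h)"
    by (simp add: bracket_poly_left[OF assms] sum_negf)
  also have "\<dots> = (\<Sum>v\<in>UNIV. subst_gens (partial v G) * br h (tg v))"
    by (simp only: anticommute[OF tg_char_ring h])
  finally show ?thesis .
qed

text \<open>
  By the Leibniz rule in both arguments, \<open>{F, G}\<close> is the sum of \<open>(\<partial>F/\<partial>z\<^sub>u)(\<partial>G/\<partial>z\<^sub>v){t\<^sub>u, t\<^sub>v}\<close>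
  over all ordered pairs. Splitting \<open>{t\<^sub>u, t\<^sub>v}\<close> and exchanging \<open>u\<close> and \<open>v\<close> in one part gives
  the bi-vector formula.
\<close>

lemma poisson_bivector_fieldI:
  assumes "\<And>u v. br (tg u) (tg v) = b u v - b v u"
  shows "is_poisson_bivector_field br b"
  unfolding is_poisson_bivector_field_def
proof (intro ballI)
  fix F G assume FG: "F \<in> poly_fun" "G \<in> poly_fun"
  let ?F = "\<lambda>u. subst_gens (partial u F)" and ?G = "\<lambda>v. subst_gens (partial v G)"
  have "br (subst_gens F) (subst_gens G) = (\<Sum>u\<in>UNIV. \<Sum>v\<in>UNIV. ?F u * (?G v * (b u v - b v u)))"
    by (simp only: bracket_poly_left[OF FG(1) subst_gens_char_ring[OF FG(2)]]
        bracket_poly_right[OF FG(2) tg_char_ring] assms sum_distrib_left)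
  also have "\<dots> = (\<Sum>u\<in>UNIV. \<Sum>v\<in>UNIV. b u v * (?F u * ?G v)) - (\<Sum>u\<in>UNIV. \<Sum>v\<in>UNIV. b v u * (?F u * ?G v))"
    by (simp only: sum_subtractf[symmetric] right_diff_distrib mult_ac)
  also have "(\<Sum>u\<in>UNIV. \<Sum>v\<in>UNIV. b v u * (?F u * ?G v)) = (\<Sum>u\<in>UNIV. \<Sum>v\<in>UNIV. b u v * (?F v * ?G u))"
    by (rule sum.swap)
  also have "(\<Sum>u\<in>UNIV. \<Sum>v\<in>UNIV. b u v * (?F u * ?G v)) - \<dots> = bv_bracket b F G"
    unfolding bv_bracket_def by (simp only: sum_subtractf[symmetric] right_diff_distrib)
  finally show "br (subst_gens F) (subst_gens G) = bv_bracket b F G" .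
qed

end

section \<open>The bi-vector field\<close>

lemma bv_act_involution:
  assumes "\<And>u. \<pi> (\<pi> u) = u"
  shows "bv_act \<sigma> \<pi> b u v = ring_act \<sigma> (b (\<pi> u) (\<pi> v))"
proof -
  have "inv \<pi> = \<pi>" using assms by (intro inv_unique_comp) (simp_all add: fun_eq_iff)
  then show ?thesis by (simp add: bv_act_def)
qed

lemma D_t_apply: "D_t b u v = ring_act t_letter (b (t_coord u) (t_coord v))"
proof -
  have "t_coord (t_coord u) = u" for u by (cases u) simp_all
  then show ?thesis by (simp add: D_t_def bv_act_involution)
qed

lemma D_i1_apply: "D_i1 b u v = ring_act i1_letter (b (i1_coord u) (i1_coord v))"
proof -
  have "i1_coord (i1_coord u) = u" for u by (cases u) simp_all
  then show ?thesis by (simp add: D_i1_def bv_act_involution)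
qed

lemma scal_0: "scal c 0 = 0"
  by (simp add: scal_def fun_eq_iff)

text \<open>Each term of \<open>\<Sigma>\<^sub>1\<Sigma>\<^sub>2\<close> occurs twice.\<close>

lemma scal_half_twice: "scal (1/2) (2 * f) = f"
  by (simp add: scal_def fun_eq_iff)

text \<open>
  An arbitrary order of the generators, which orients anticommutativity into a terminating
  rewriting rule.
\<close>

fun coord_rank :: "coord \<Rightarrow> nat" where
  "coord_rank Z1 = 1"
| "coord_rank Zm1 = 2"
| "coord_rank Z2 = 3"
| "coord_rank Zm2 = 4"
| "coord_rank Z3 = 5"
| "coord_rank Zm3 = 6"
| "coord_rank Z4 = 7"
| "coord_rank Zm4 = 8"
| "coord_rank Z5 = 9"

theorem theorem29:
  fixes br :: "(rep \<Rightarrow> complex) \<Rightarrow> (rep \<Rightarrow> complex) \<Rightarrow> (rep \<Rightarrow> complex)"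
  assumes "goldman_bracket br"
  shows "is_poisson_bivector_field br
           (Sigma1 (bv_term (br (tg Z1) (tg Z2)) Z1 Z2)
            + Sigma2 (bv_term (br (tg Z3) (tg Z4)) Z3 Z4)
            + bv_scal (1/2) (Sigma1 (Sigma2
                (bv_term (br (tg Z1) (tg Z3)) Z1 Z3 + bv_term (br (tg Z1) (tg Zm3)) Z1 Zm3))))
    \<and> br (tg Z1) (tg Z2) = tg Z3 - scal (1/3) (tg Z1 * tg Z2)
    \<and> br (tg Z1) (tg Z3) = scal (2/3) (tg Z1 * tg Z3) - tg Zm1 * tg Z2 + tg Zm4
    \<and> br (tg Z1) (tg Zm3) = - tg Zm2 + scal (1/3) (tg Z1 * tg Zm3)
    \<and> br (tg Z3) (tg Z4) = - (tg Z1 ^ 2) + tg Zm1 - tg Zm4 * tg Zm2 - tg Z2 * tg Zm3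
           + tg Zm1 * tg Z2 * tg Zm2 - scal (1/3) (tg Z3 * tg Z4)"
proof (intro conjI)
  interpret goldman_bracket br by fact
  have anti: "br (tg v) (tg u) = - br (tg u) (tg v)" for u v
    by (intro anticommute tg_char_ring)
  have zero: "br (tg Z1) (tg Zm1) = 0" "br (tg Z3) (tg Zm3) = 0" "br (tg u) (tg u) = 0"
     "br (tg Z5) (tg u) = 0" "br (tg u) (tg Z5) = 0" for u
  proof -
    show "br (tg Z1) (tg Zm1) = 0" "br (tg Z3) (tg Zm3) = 0" "br (tg u) (tg u) = 0"
      using bracket_1_m1 bracket_3_m3 bracket_value_self[OF tg_char_ring] assms
      by (blast intro: bracket_valueD)+
    show "br (tg Z5) (tg u) = 0"
      by (rule bracket_Z5) fact
    then show "br (tg u) (tg Z5) = 0"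
      using anti[of u Z5] by simp
  qed
  have zero': "br (tg Z2) (tg Zm2) = 0" "br (tg Z4) (tg Zm4) = 0"
  proof -
    show "br (tg Z2) (tg Zm2) = 0"
      using bracket_anti_equivariant(1)[OF assms, of Z1 Zm1] by (simp add: zero ring_act_0)
    have "br (tg Zm4) (tg Z4) = 0"
      using bracket_anti_equivariant(2)[OF assms, of Z3 Zm3] by (simp add: zero ring_act_0)
    then show "br (tg Z4) (tg Zm4) = 0"
      using anti[of Z4 Zm4] by simp
  qed
  show "is_poisson_bivector_field br
           (Sigma1 (bv_term (br (tg Z1) (tg Z2)) Z1 Z2)
            + Sigma2 (bv_term (br (tg Z3) (tg Z4)) Z3 Z4)
            + bv_scal (1/2) (Sigma1 (Sigma2
                (bv_term (br (tg Z1) (tg Z3)) Z1 Z3 + bv_term (br (tg Z1) (tg Zm3)) Z1 Zm3))))"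
    (is "is_poisson_bivector_field br (?B1 + ?B2 + bv_scal (1/2) ?B3)")
  proof (rule poisson_bivector_fieldI)
    note simps = Sigma1_def Sigma2_def D_i_def D_i2_def D_t_apply D_i1_apply bv_term_def bv_scal_def
      ring_act_hom bracket_anti_equivariant[OF assms] scal_half_twice scal_0
        have anti_ordered: "br (tg v) (tg u) = - br (tg u) (tg v)" if "coord_rank u < coord_rank v" for u v
      by (rule anti)
    fix u v
    show "br (tg u) (tg v) = (?B1 + ?B2 + bv_scal (1/2) ?B3) u v - (?B1 + ?B2 + bv_scal (1/2) ?B3) v u"
      by (cases u; cases v) (simp_all add: simps zero zero' anti_ordered)
  qed
qed (rule bracket_valueD[OF bracket_1_2] bracket_valueD[OF bracket_1_3]
    bracket_valueD[OF bracket_1_m3] bracket_valueD[OF bracket_3_4], fact)+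

end
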